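(* Let $d\in 2^{<\omega}$, $s\in\prod_{n<|d|}b(n)$ and $k<\omega$ be such that $d$ is long with respect to $k$. Then $Q_{d,s,k}\subseteq\mathbb{LE}_b$ is $(D,\frac{1}{|d|})$-lim-linked for every non-principal ultrafilter $D$ on $\omega$. As a consequence, $\mathbb{LE}_b$ has $\mathrm{UFIC}$-limits, i.e. it is $\sigma$-$\mathrm{UFIC}$-lim-linked.
   Context: Fix $b\in\omega^\omega$ with $b(n)\geq 2^n$ for all $n<\omega$. The poset $\mathbb{LE}_b$: conditions are triples $(d,s,\varphi)$ with $d\in2^{<\omega}$, $s\in\prod_{n<|d|}b(n)$, $\varphi\in\prod_{n<\omega}\mathcal P(b(n))$ such that for some $k<\omega$, $\frac{|\varphi(n)|}{b(n)}\leq 2^{-n/2^k}$ for all $n\geq|d|$. The order is: $(d',s',\varphi')\leq(d,s,\varphi)$ if $d'\supseteq d$, $s'\supseteq s$, $\varphi'(n)\supseteq\varphi(n)$ for all $n<\omega$, and $s'(n)\notin\varphi(n)$ for all $n\in(d')^{-1}(\{1\})\setminus d^{-1}(\{1\})$. For $d\in2^{<\omega}$, $s\in\prod_{n<|d|}b(n)$, $k<\omega$, let $Q_{d,s,k}$ be the set of conditions $(d,s,\varphi)\in\mathbb{LE}_b$ (with first two coordinates exactly $d$ and $s$) such that $\frac{|\varphi(n)|}{b(n)}\leq2^{-n/2^k}$ for all $n\geq|d|$. $d\in2^{<\omega}$ is long (with respect to $k$) if $|d|\geq2$ and $2^{-n/2^k}\leq\frac{1}{n^2(n+1)^2}$ for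 all $n\geq|d|$. Fix the partition $\langle I_k\rangle_{k<\omega}$ of $\omega$ into consecutive intervals with $|I_k|=2^k$. For a poset $\mathbb P$ and $\bar q=\langle q_l\rangle_{l<\omega}\in\mathbb P^\omega$, let $\dot d_k(\bar q)$ be the $\mathbb P$-name for $\frac{|\{l\in I_k:q_l\in\dot G\}|}{|I_k|}$, where $\dot G$ is the canonical name of the generic filter. For rational $\varepsilon\in(0,1)$ and a non-principal ultrafilter $D$ on $\omega$, a set $Q\subseteq\mathbb P$ is $(D,\varepsilon)$-lim-linked if there are a $\mathbb P$-name $\dot D'$ of an ultrafilter on $\omega$ extending $D$ and a function $\lim^{D,\varepsilon}\colon Q^\omega\to\mathbb P$ such that for every $\bar q\in Q^\omega$, $\lim^{D,\varepsilon}\bar q\Vdash\{k<\omega:\dot d_k(\bar q)\geq1-\varepsilon\}\in\dot D'$. $\mathbb P$ is $\sigma$-$\mathrm{UFIC}$-lim-linked (has $\mathrm{UFIC}$-limits) if there is a family $\langle Q_{\alpha,\varepsilon}:\alpha<\omega,\ \varepsilon\in(0,1)\cap\mathbb Q\rangle$ of subsets of $\mathbb P$ such that each $Q_{\alpha,\varepsilon}$ is centered (every finite subset has a common lower bound in $\mathbb P$), each $Q_{\alpha,\varepsilon}$ is $(D,\varepsilon)$-lim-linked for every non-principal ultrafilter $D$ on $\omega$, and for each $\varepsilon$ the set $\bigcup_{\alpha<\omega}Q_{\alpha,\varepsilon}$ is dense in $\mathbb P$. *)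

theory Defs
  imports Complex_Main "HOL-Library.FuncSet" "HOL-Library.Sublist"
begin

section \<open>Ultrafilters in the ground model\<close>

definition ultrafilter :: "nat set set \<Rightarrow> bool" where
  "ultrafilter D \<longleftrightarrow>
     UNIV \<in> D \<and> {} \<notin> D \<and>
     (\<forall>X Y. X \<in> D \<and> X \<subseteq> Y \<longrightarrow> Y \<in> D) \<and>
     (\<forall>X Y. X \<in> D \<and> Y \<in> D \<longrightarrow> X \<inter> Y \<in> D) \<and>
     (\<forall>X. X \<in> D \<or> - X \<in> D)"

definition nonprincipal_ultrafilter :: "nat set set \<Rightarrow> bool" where
  "nonprincipal_ultrafilter D \<longleftrightarrow> ultrafilter D \<and> (\<forall>n. {n} \<notin> D)"

section \<open>Forcing\<close>

text \<open>
  A name for a subset of (the check name of) a ground model set \<open>A :: 'a set\<close> is a set of pairs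
  \<open>(a, p)\<close>, standing for \<open>(check a, p)\<close>; if \<open>G\<close> is generic, it is evaluated to
  \<open>{a. \<exists>p \<in> G. (a, p) \<in> \<sigma>}\<close>. A name for a set of subsets of \<open>\<omega>\<close> is a set of pairs \<open>(\<sigma>, p)\<close> where
  \<open>\<sigma>\<close> is a name for a subset of \<open>\<omega>\<close>. In a generic extension, every subset of \<open>\<omega>\<close> and every set of
  subsets of \<open>\<omega>\<close> is the value of such a name.
\<close>

type_synonym ('a, 'p) name = "('a \<times> 'p) set"
type_synonym 'p family_name = "((nat, 'p) name \<times> 'p) set"

text \<open>
  A sentence of the forcing language is identified with the property of being a condition that
  forces it. The connectives and atomic sentences below are the clauses of the usual recursive
  definition of the forcing relation in the ground model.
\<close>

type_synonym 'p sentence = "'p \<Rightarrow> bool"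

locale forcing_poset =
  fixes P :: "'p set" and le :: "'p \<Rightarrow> 'p \<Rightarrow> bool" (infix \<open>\<preceq>\<close> 50)
  assumes le_refl: "p \<in> P \<Longrightarrow> p \<preceq> p"
    and le_trans: "p \<in> P \<Longrightarrow> q \<in> P \<Longrightarrow> r \<in> P \<Longrightarrow> p \<preceq> q \<Longrightarrow> q \<preceq> r \<Longrightarrow> p \<preceq> r"
    and le_antisym: "p \<in> P \<Longrightarrow> q \<in> P \<Longrightarrow> p \<preceq> q \<Longrightarrow> q \<preceq> p \<Longrightarrow> p = q"
begin

definition dense_below :: "'p \<Rightarrow> 'p set \<Rightarrow> bool" where
  "dense_below p A \<longleftrightarrow> (\<forall>q\<in>P. q \<preceq> p \<longrightarrow> (\<exists>r\<in>P. r \<preceq> q \<and> r \<in> A))"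

definition forces :: "'p \<Rightarrow> 'p sentence \<Rightarrow> bool" (infix \<open>\<tturnstile>\<close> 20) where
  "(p \<tturnstile> \<phi>) \<longleftrightarrow> p \<in> P \<and> \<phi> p"

definition forced :: "'p sentence \<Rightarrow> bool" where
  "forced \<phi> \<longleftrightarrow> (\<forall>p\<in>P. p \<tturnstile> \<phi>)"

definition fNot :: "'p sentence \<Rightarrow> 'p sentence" where
  "fNot \<phi> = (\<lambda>p. \<forall>q\<in>P. q \<preceq> p \<longrightarrow> \<not> \<phi> q)"

definition fAnd :: "'p sentence \<Rightarrow> 'p sentence \<Rightarrow> 'p sentence" (infixr \<open>\<^bold>\<and>\<close> 35) where
  "(\<phi> \<^bold>\<and> \<psi>) = (\<lambda>p. \<phi> p \<and> \<psi> p)"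

definition fOr :: "'p sentence \<Rightarrow> 'p sentence \<Rightarrow> 'p sentence" (infixr \<open>\<^bold>\<or>\<close> 30) where
  "(\<phi> \<^bold>\<or> \<psi>) = (\<lambda>p. dense_below p {q. \<phi> q \<or> \<psi> q})"

definition fImp :: "'p sentence \<Rightarrow> 'p sentence \<Rightarrow> 'p sentence" (infixr \<open>\<^bold>\<longrightarrow>\<close> 25) where
  "(\<phi> \<^bold>\<longrightarrow> \<psi>) = (\<lambda>p. \<forall>q\<in>P. q \<preceq> p \<longrightarrow> \<phi> q \<longrightarrow> \<psi> q)"

definition fIff :: "'p sentence \<Rightarrow> 'p sentence \<Rightarrow> 'p sentence" (infixr \<open>\<^bold>\<longleftrightarrow>\<close> 25) where
  "(\<phi> \<^bold>\<longleftrightarrow> \<psi>) = ((\<phi> \<^bold>\<longrightarrow> \<psi>) \<^bold>\<and> (\<psi> \<^bold>\<longrightarrow> \<phi>))"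

text \<open>
  The range \<open>S\<close> of a quantifier is a set of ground model elements (so that the quantifier is bounded
  by a check name) or the set of all names for subsets of \<open>\<omega>\<close>.
\<close>

definition fAll :: "'x set \<Rightarrow> ('x \<Rightarrow> 'p sentence) \<Rightarrow> 'p sentence" where
  "fAll S \<phi> = (\<lambda>p. \<forall>x\<in>S. \<phi> x p)"

definition fEx :: "'x set \<Rightarrow> ('x \<Rightarrow> 'p sentence) \<Rightarrow> 'p sentence" where
  "fEx S \<phi> = (\<lambda>p. dense_below p {q. \<exists>x\<in>S. \<phi> x q})"

definition names :: "('a, 'p) name set" where
  "names = {\<sigma>. \<sigma> \<subseteq> UNIV \<times> P}"

definition family_names :: "'p family_name set" where
  "family_names = {\<Delta>. \<Delta> \<subseteq> names \<times> P}"

definition mem :: "'a \<Rightarrow> ('a, 'p) name \<Rightarrow> 'p sentence" (infix \<open>\<^bold>\<in>\<close> 50) where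
  "(a \<^bold>\<in> \<sigma>) = (\<lambda>p. dense_below p {q. \<exists>r\<in>P. (a, r) \<in> \<sigma> \<and> q \<preceq> r})"

definition eq :: "('a, 'p) name \<Rightarrow> ('a, 'p) name \<Rightarrow> 'p sentence" (infix \<open>\<^bold>=\<close> 50) where
  "(\<sigma> \<^bold>= \<tau>) = fAll UNIV (\<lambda>a. a \<^bold>\<in> \<sigma> \<^bold>\<longleftrightarrow> a \<^bold>\<in> \<tau>)"

definition family_mem :: "(nat, 'p) name \<Rightarrow> 'p family_name \<Rightarrow> 'p sentence" (infix \<open>\<^bold>\<in>\<^bold>\<in>\<close> 50) where
  "(\<sigma> \<^bold>\<in>\<^bold>\<in> \<Delta>) = (\<lambda>p. dense_below p {q. \<exists>(\<tau>, r)\<in>\<Delta>. r \<in> P \<and> q \<preceq> r \<and> (\<sigma> \<^bold>= \<tau>) q})"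

definition check :: "'a set \<Rightarrow> ('a, 'p) name" where
  "check A = A \<times> P"

text \<open>The canonical name for \<open>{a. \<phi> a}\<close>.\<close>

definition comprehension :: "('a \<Rightarrow> 'p sentence) \<Rightarrow> ('a, 'p) name" where
  "comprehension \<phi> = {(a, p). p \<tturnstile> \<phi> a}"

definition generic_name :: "('p, 'p) name" where
  "generic_name = {(p, p) | p. p \<in> P}"

text \<open>The sentence saying that \<open>\<Delta>\<close> is an ultrafilter on \<open>\<omega>\<close>, clause by clause as above.\<close>

definition is_ultrafilter :: "'p family_name \<Rightarrow> 'p sentence" where
  "is_ultrafilter \<Delta> =
     (fAll names (\<lambda>X. fAll UNIV (\<lambda>n. n \<^bold>\<in> X) \<^bold>\<longrightarrow> X \<^bold>\<in>\<^bold>\<in> \<Delta>) \<^bold>\<and>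
      fAll names (\<lambda>X. fAll UNIV (\<lambda>n. fNot (n \<^bold>\<in> X)) \<^bold>\<longrightarrow> fNot (X \<^bold>\<in>\<^bold>\<in> \<Delta>)) \<^bold>\<and>
      fAll names (\<lambda>X. fAll names (\<lambda>Y.
        X \<^bold>\<in>\<^bold>\<in> \<Delta> \<^bold>\<and> fAll UNIV (\<lambda>n. n \<^bold>\<in> X \<^bold>\<longrightarrow> n \<^bold>\<in> Y) \<^bold>\<longrightarrow> Y \<^bold>\<in>\<^bold>\<in> \<Delta>)) \<^bold>\<and>
      fAll names (\<lambda>X. fAll names (\<lambda>Y. fAll names (\<lambda>Z.
        X \<^bold>\<in>\<^bold>\<in> \<Delta> \<^bold>\<and> Y \<^bold>\<in>\<^bold>\<in> \<Delta> \<^bold>\<and> fAll UNIV (\<lambda>n. n \<^bold>\<in> Z \<^bold>\<longleftrightarrow> n \<^bold>\<in> X \<^bold>\<and> n \<^bold>\<in> Y)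
          \<^bold>\<longrightarrow> Z \<^bold>\<in>\<^bold>\<in> \<Delta>))) \<^bold>\<and>
      fAll names (\<lambda>X. fAll names (\<lambda>Y.
        fAll UNIV (\<lambda>n. n \<^bold>\<in> Y \<^bold>\<longleftrightarrow> fNot (n \<^bold>\<in> X)) \<^bold>\<longrightarrow> X \<^bold>\<in>\<^bold>\<in> \<Delta> \<^bold>\<or> Y \<^bold>\<in>\<^bold>\<in> \<Delta>)))"

definition ultrafilter_name_extending :: "nat set set \<Rightarrow> 'p family_name \<Rightarrow> bool" where
  "ultrafilter_name_extending D \<Delta> \<longleftrightarrow>
     \<Delta> \<in> family_names \<and> forced (is_ultrafilter \<Delta>) \<and> forced (fAll D (\<lambda>A. check A \<^bold>\<in>\<^bold>\<in> \<Delta>))"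

section \<open>Linkedness notions\<close>

definition interval :: "nat \<Rightarrow> nat set" where
  "interval k = {2 ^ k - 1 ..< 2 ^ (k + 1) - 1}"

text \<open>The name for \<open>{l \<in> I\<^sub>k. q\<^sub>l \<in> G}\<close>.\<close>

definition hits :: "(nat \<Rightarrow> 'p) \<Rightarrow> nat \<Rightarrow> (nat, 'p) name" where
  "hits q k = comprehension (\<lambda>l p. l \<in> interval k \<and> (q l \<^bold>\<in> generic_name) p)"

text \<open>
  The name for the rational number \<open>card {l \<in> I\<^sub>k. q\<^sub>l \<in> G} / card I\<^sub>k\<close>. A name for a rational number
  is given as a name for the singleton of that number.
\<close>

definition density :: "(nat \<Rightarrow> 'p) \<Rightarrow> nat \<Rightarrow> (rat, 'p) name" where
  "density q k = comprehension (\<lambda>x.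
     fEx {S. S \<subseteq> interval k \<and> x = of_nat (card S) / of_nat (card (interval k))}
       (\<lambda>S. hits q k \<^bold>= check S))"

definition density_ge :: "(nat \<Rightarrow> 'p) \<Rightarrow> nat \<Rightarrow> rat \<Rightarrow> 'p sentence" where
  "density_ge q k c = fEx {x. x \<ge> c} (\<lambda>x. x \<^bold>\<in> density q k)"

definition lim_linked :: "nat set set \<Rightarrow> rat \<Rightarrow> 'p set \<Rightarrow> bool" where
  "lim_linked D \<epsilon> Q \<longleftrightarrow> Q \<subseteq> P \<and>
     (\<exists>D' lim. ultrafilter_name_extending D D' \<and> lim \<in> (UNIV \<rightarrow> Q) \<rightarrow> P \<and>
        (\<forall>q \<in> UNIV \<rightarrow> Q. lim q \<tturnstile> comprehension (\<lambda>k. density_ge q k (1 - \<epsilon>)) \<^bold>\<in>\<^bold>\<in> D'))"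

definition centered :: "'p set \<Rightarrow> bool" where
  "centered Q \<longleftrightarrow> Q \<subseteq> P \<and> (\<forall>F. finite F \<and> F \<subseteq> Q \<longrightarrow> (\<exists>r\<in>P. \<forall>q\<in>F. r \<preceq> q))"

definition dense :: "'p set \<Rightarrow> bool" where
  "dense A \<longleftrightarrow> A \<subseteq> P \<and> (\<forall>p\<in>P. \<exists>q\<in>A. q \<preceq> p)"

definition sigma_UFIC_lim_linked :: bool where
  "sigma_UFIC_lim_linked \<longleftrightarrow>
     (\<exists>Q :: nat \<Rightarrow> rat \<Rightarrow> 'p set. \<forall>\<epsilon>. 0 < \<epsilon> \<and> \<epsilon> < 1 \<longrightarrow>
        (\<forall>\<alpha>. Q \<alpha> \<epsilon> \<subseteq> P \<and> centered (Q \<alpha> \<epsilon>) \<and>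
             (\<forall>D. nonprincipal_ultrafilter D \<longrightarrow> lim_linked D \<epsilon> (Q \<alpha> \<epsilon>))) \<and>
        dense (\<Union>\<alpha>. Q \<alpha> \<epsilon>))"

end

section \<open>The forcing notion\<close>

text \<open>
  The number \<open>b n\<close> is identified with \<open>{..<b n}\<close>, and the elements of \<open>2\<^sup><\<^sup>\<omega>\<close> are lists of
  Booleans, with \<open>True\<close> for \<open>1\<close>.
\<close>

type_synonym cond = "bool list \<times> nat list \<times> (nat \<Rightarrow> nat set)"

definition seqs :: "(nat \<Rightarrow> nat) \<Rightarrow> nat \<Rightarrow> nat list set" where
  "seqs b m = {s. length s = m \<and> (\<forall>n<m. s ! n < b n)}"

definition slalom_bound :: "(nat \<Rightarrow> nat) \<Rightarrow> nat \<Rightarrow> nat \<Rightarrow> (nat \<Rightarrow> nat set) \<Rightarrow> bool" where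
  "slalom_bound b m k \<phi> \<longleftrightarrow>
     (\<forall>n\<ge>m. real (card (\<phi> n)) / real (b n) \<le> 2 powr (- (real n / 2 ^ k)))"

definition LE :: "(nat \<Rightarrow> nat) \<Rightarrow> cond set" where
  "LE b = {(d, s, \<phi>). s \<in> seqs b (length d) \<and> (\<forall>n. \<phi> n \<subseteq> {..<b n}) \<and>
                      (\<exists>k. slalom_bound b (length d) k \<phi>)}"

definition ones :: "bool list \<Rightarrow> nat set" where
  "ones d = {n. n < length d \<and> d ! n}"

fun LE_le :: "cond \<Rightarrow> cond \<Rightarrow> bool" where
  "LE_le (d', s', \<phi>') (d, s, \<phi>) \<longleftrightarrow>
     prefix d d' \<and> prefix s s' \<and> (\<forall>n. \<phi> n \<subseteq> \<phi>' n) \<and> (\<forall>n \<in> ones d' - ones d. s' ! n \<notin> \<phi> n)"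

definition LE_Q :: "(nat \<Rightarrow> nat) \<Rightarrow> bool list \<Rightarrow> nat list \<Rightarrow> nat \<Rightarrow> cond set" where
  "LE_Q b d s k = {(d', s', \<phi>) \<in> LE b. d' = d \<and> s' = s \<and> slalom_bound b (length d) k \<phi>}"

definition long :: "nat \<Rightarrow> bool list \<Rightarrow> bool" where
  "long k d \<longleftrightarrow> length d \<ge> 2 \<and>
     (\<forall>n\<ge>length d. 2 powr (- (real n / 2 ^ k)) \<le> 1 / ((real n)\<^sup>2 * (real n + 1)\<^sup>2))"

lemma forcing_poset_LE: "forcing_poset (LE b) LE_le"
proof
  fix p assume "p \<in> LE b"
  then show "LE_le p p" by (cases p) auto
next
  fix p q assume "LE_le p q" "LE_le q p"
  then show "p = q" by (cases p; cases q) (fastforce intro: prefix_order.antisym)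
next
  fix p q r assume P: "p \<in> LE b" "q \<in> LE b" and le: "LE_le p q" "LE_le q r"
  obtain d s \<phi> d' s' \<phi>' d'' s'' \<phi>''
    where [simp]: "p = (d'', s'', \<phi>'')" "q = (d', s', \<phi>')" "r = (d, s, \<phi>)"
    by (metis prod_cases3)
  have "s'' ! n \<notin> \<phi> n" if n: "n \<in> ones d''" "n \<notin> ones d" for n
  proof (cases "n \<in> ones d'")
    case True
    then have "n < length s'" using P by (auto simp: LE_def seqs_def ones_def)
    then have "s'' ! n = s' ! n" using le by (auto simp: prefix_def nth_append)
    then show ?thesis using le n True by auto
  next
    case False
    then show ?thesis using le n by fastforce
  qed
  moreover have "\<phi> n \<subseteq> \<phi>'' n" for n using le by (simp, meson subset_trans)
  ultimately show "LE_le p r" using le by (auto intro: prefix_order.trans)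
qed

end

theory Submission
  imports Defs "HOL-Library.Countable_Set" "HOL-Real_Asymp.Real_Asymp"
begin

text \<open>
  A poset name of an ultrafilter can be found without passing to a generic extension. Consider a set
  \<open>F\<close> of pairs \<open>(X, p)\<close>, where \<open>X\<close> names a subset of \<open>\<omega>\<close>, read as the promise that \<open>p\<close> puts \<open>X\<close>
  into the ultrafilter. If every finite part of \<open>F\<close> can be met below every condition that is
  committed to it (\<open>has_fip\<close>), then so it is for a maximal superset of \<open>F\<close> with this property, as the
  property has finite character. Maximality makes such a set the name of an ultrafilter
  (\<open>maximal_fip_is_ultrafilter\<close>). Hence linkedness reduces to a combinatorial property of the
  poset: a condition below finitely many limits of sequences \<open>q\<close> has, for some \<open>k\<close> in any given set
  of \<open>D\<close>, an extension that lies below \<open>q l\<close> for most \<open>l\<close> in the \<open>k\<close>-th interval, simultaneously for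
  all these \<open>q\<close> (\<open>lim_linkedI\<close>).

  For a sequence of conditions \<open>(d, s, \<phi>\<^sub>l)\<close>, the limit is \<open>(d, s, \<psi>)\<close>, where \<open>\<psi> n\<close> collects the \<open>i\<close>
  that lie in \<open>\<phi>\<^sub>l n\<close> with frequency at least \<open>\<delta>\<^sub>n = 1 / (n (n + 1))\<close> along \<open>D\<close>-many intervals. Double
  counting gives \<open>card (\<psi> n) \<le> b n * 2\<^bsup>-n/2^k\<^esup> / \<delta>\<^sub>n\<close>, and longness of \<open>d\<close> says that dividing by
  \<open>\<delta>\<^sub>n\<close> costs at most the square root of the bound, that is, the passage from \<open>k\<close> to \<open>k + 1\<close>. If
  \<open>(d', s', _)\<close> is below the limit, then for \<open>D\<close>-many intervals each value
  \<open>s' ! n\<close> at a new one of \<open>d'\<close> lies in \<open>\<phi>\<^sub>l n\<close> with frequency less than \<open>\<delta>\<^sub>n\<close>. As \<open>\<Sum>n\<ge>m. \<delta>\<^sub>n = 1 / m\<close> telescopes, all these values avoid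
  \<open>\<phi>\<^sub>l\<close> for a proportion of at least \<open>1 - 1 / length d\<close> of the \<open>l\<close> in such an interval. Finitely many
  conditions whose stems are obeyed by \<open>(d', s')\<close> have a common lower bound
  (\<open>common_lower_bound\<close>): append zeros to \<open>d'\<close> until the union of their slaloms is small enough.
\<close>

section \<open>Names of ultrafilters\<close>

context forcing_poset
begin

lemma dense_below_mono:
  assumes "dense_below p A" "q \<preceq> p" "p \<in> P" "q \<in> P"
  shows "dense_below q A"
  unfolding dense_below_def
proof (intro ballI impI)
  fix r assume r: "r \<in> P" "r \<preceq> q"
  then have "r \<preceq> p" using le_trans[of r q p] assms(2-4) by blast
  then show "\<exists>t\<in>P. t \<preceq> r \<and> t \<in> A" using assms(1) r(1) unfolding dense_below_def by blast
qed

lemma mem_mono: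
  assumes "(a \<^bold>\<in> \<sigma>) p" "q \<preceq> p" "p \<in> P" "q \<in> P"
  shows "(a \<^bold>\<in> \<sigma>) q"
  using assms(1) unfolding mem_def by (rule dense_below_mono) (fact assms)+

lemma fNot_mono:
  assumes "fNot \<phi> p" "q \<preceq> p" "p \<in> P" "q \<in> P"
  shows "fNot \<phi> q"
  unfolding fNot_def
proof (intro ballI impI)
  fix r assume r: "r \<in> P" "r \<preceq> q"
  then have "r \<preceq> p" using le_trans[of r q p] assms(2-4) by blast
  then show "\<not> \<phi> r" using assms(1) r(1) unfolding fNot_def by blast
qed

lemma eq_memD:
  assumes "(\<sigma> \<^bold>= \<tau>) p" "q \<preceq> p" "q \<in> P" "(a \<^bold>\<in> \<tau>) q"
  shows "(a \<^bold>\<in> \<sigma>) q"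
  using assms unfolding eq_def fAll_def fIff_def fAnd_def fImp_def by blast

lemma eq_refl: "(\<sigma> \<^bold>= \<sigma>) p"
  unfolding eq_def fAll_def fIff_def fAnd_def fImp_def by blast

lemma memI:
  assumes "(a, r) \<in> \<sigma>" "r \<in> P" "p \<in> P" "p \<preceq> r"
  shows "(a \<^bold>\<in> \<sigma>) p"
  unfolding mem_def dense_below_def
proof (intro ballI impI)
  fix q assume q: "q \<in> P" "q \<preceq> p"
  have "q \<preceq> r" using le_trans[of q p r] q assms by blast
  then show "\<exists>t\<in>P. t \<preceq> q \<and> t \<in> {t. \<exists>r\<in>P. (a, r) \<in> \<sigma> \<and> t \<preceq> r}"
    using q(1) le_refl[of q] assms by blast
qed

lemma mem_check_iff:
  assumes "p \<in> P"
  shows "(a \<^bold>\<in> check A) p \<longleftrightarrow> a \<in> A"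
proof
  assume "(a \<^bold>\<in> check A) p"
  then show "a \<in> A"
    using assms le_refl[of p] unfolding mem_def dense_below_def check_def by blast
next
  assume "a \<in> A"
  then show "(a \<^bold>\<in> check A) p"
    using assms le_refl[of p] by (intro memI[where r = p]) (auto simp: check_def)
qed

lemma mem_comprehensionI:
  assumes "\<phi> a p" "p \<in> P"
  shows "(a \<^bold>\<in> comprehension \<phi>) p"
  using assms le_refl by (intro memI[where r = p]) (auto simp: comprehension_def forces_def)

lemma comprehension_in_names: "comprehension \<phi> \<in> names"
  by (auto simp: comprehension_def forces_def names_def)

text \<open>
  For a set of promises \<open>(X, p)\<close>, this says that the sets promised by the generic filter are forced
  to have the finite intersection property.
\<close>

definition has_fip :: "'p family_name \<Rightarrow> bool" where
  "has_fip F \<longleftrightarrow> (\<forall>E r. finite E \<longrightarrow> E \<subseteq> F \<longrightarrow> r \<in> P \<longrightarrow> (\<forall>X p. (X, p) \<in> E \<longrightarrow> r \<preceq> p) \<longrightarrow>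
     (\<exists>r'\<in>P. \<exists>n. r' \<preceq> r \<and> (\<forall>X p. (X, p) \<in> E \<longrightarrow> (n \<^bold>\<in> X) r')))"

definition maximal_fip :: "'p family_name \<Rightarrow> bool" where
  "maximal_fip F \<longleftrightarrow> F \<in> family_names \<and> has_fip F \<and>
     (\<forall>F' \<in> family_names. has_fip F' \<longrightarrow> F \<subseteq> F' \<longrightarrow> F' = F)"

lemma has_fipD:
  assumes "has_fip F" "finite E" "E \<subseteq> F" "r \<in> P" "\<And>X p. (X, p) \<in> E \<Longrightarrow> r \<preceq> p"
  obtains r' n where "r' \<in> P" "r' \<preceq> r" "\<And>X p. (X, p) \<in> E \<Longrightarrow> (n \<^bold>\<in> X) r'"
proof -
  have "\<forall>X p. (X, p) \<in> E \<longrightarrow> r \<preceq> p" using assms(5) by blast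
  then have "\<exists>r'\<in>P. \<exists>n. r' \<preceq> r \<and> (\<forall>X p. (X, p) \<in> E \<longrightarrow> (n \<^bold>\<in> X) r')"
    using assms(1-4) unfolding has_fip_def by meson
  then show thesis using that by blast
qed

lemma has_fip_singleton:
  assumes "has_fip F" "(X, p) \<in> F" "p \<in> P"
  shows "\<exists>r\<in>P. \<exists>n. r \<preceq> p \<and> (n \<^bold>\<in> X) r"
  by (rule has_fipD[OF assms(1), of "{(X, p)}" p]) (use assms le_refl in auto)

lemma maximal_fip_exists:
  assumes "F \<in> family_names" "has_fip F"
  shows "\<exists>M. F \<subseteq> M \<and> maximal_fip M"
proof -
  let ?A = "{F' \<in> family_names. F \<subseteq> F' \<and> has_fip F'}"
  have "\<exists>M\<in>?A. \<forall>X\<in>?A. M \<subseteq> X \<longrightarrow> X = M"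
  proof (rule subset_Zorn_nonempty)
    show "?A \<noteq> {}" using assms by blast
  next
    fix C assume C: "C \<noteq> {}" "subset.chain ?A C"
    have sub: "C \<subseteq> ?A" using C(2) by (simp add: subset.chain_def)
    have "has_fip (\<Union>C)"
      unfolding has_fip_def
    proof (intro allI impI)
      fix E r assume E: "finite E" "E \<subseteq> \<Union>C" and r: "r \<in> P" "\<forall>X p. (X, p) \<in> E \<longrightarrow> r \<preceq> p"
      obtain B where "B \<in> C" "E \<subseteq> B"
        using finite_subset_Union_chain[OF E C(1)] C(2)
        by blast
      moreover from this sub have "has_fip B" by blast
      ultimately show "\<exists>r'\<in>P. \<exists>n. r' \<preceq> r \<and> (\<forall>X p. (X, p) \<in> E \<longrightarrow> (n \<^bold>\<in> X) r')"
        using E(1) r unfolding has_fip_def by meson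
    qed
    moreover have "\<Union>C \<in> family_names" using sub by (auto simp: family_names_def)
    moreover have "F \<subseteq> \<Union>C" using C(1) sub by blast
    ultimately show "\<Union>C \<in> ?A" by blast
  qed
  then obtain M where M: "M \<in> ?A" "\<And>X. X \<in> ?A \<Longrightarrow> M \<subseteq> X \<Longrightarrow> X = M" by meson
  have "maximal_fip M"
    unfolding maximal_fip_def
  proof (intro conjI ballI impI)
    show "M \<in> family_names" "has_fip M" using M(1) by auto
    fix F' assume "F' \<in> family_names" "has_fip F'" "M \<subseteq> F'"
    then show "F' = M" using M by auto
  qed
  then show ?thesis using M(1) by blast
qed

text \<open>
  A promise that is missing from a maximal set fails for a reason: below \<open>p\<close> there is a condition
  \<open>r\<close> committed to finitely many promises whose sets cannot meet \<open>X\<close> below \<open>r\<close>.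
\<close>

lemma maximal_fip_obstruction:
  assumes "maximal_fip F" "X \<in> names" "p \<in> P" "(X, p) \<notin> F"
  obtains E r where "finite E" "E \<subseteq> F" "r \<in> P" "r \<preceq> p" "\<And>Y q. (Y, q) \<in> E \<Longrightarrow> r \<preceq> q"
    "\<And>r' n. r' \<in> P \<Longrightarrow> r' \<preceq> r \<Longrightarrow> (\<And>Y q. (Y, q) \<in> E \<Longrightarrow> (n \<^bold>\<in> Y) r') \<Longrightarrow> \<not> (n \<^bold>\<in> X) r'"
proof -
  have F: "F \<in> family_names" "has_fip F" using assms(1) by (auto simp: maximal_fip_def)
  have "insert (X, p) F \<in> family_names" using F(1) assms(2,3) by (auto simp: family_names_def)
  then have "\<not> has_fip (insert (X, p) F)"
    using assms(1,4) unfolding maximal_fip_def by blast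
  then obtain E r where E: "finite E" "E \<subseteq> insert (X, p) F" "r \<in> P" "\<forall>Y q. (Y, q) \<in> E \<longrightarrow> r \<preceq> q"
    and no: "\<not> (\<exists>r'\<in>P. \<exists>n. r' \<preceq> r \<and> (\<forall>Y q. (Y, q) \<in> E \<longrightarrow> (n \<^bold>\<in> Y) r'))"
    unfolding has_fip_def by meson
  have in_E: "(X, p) \<in> E"
  proof (rule ccontr)
    assume "(X, p) \<notin> E"
    then have "E \<subseteq> F" using E(2) by blast
    then show False using F(2) E(1,3,4) no unfolding has_fip_def by meson
  qed
  show thesis
  proof (rule that[of "E - {(X, p)}" r])
    fix r' n assume r': "r' \<in> P" "r' \<preceq> r" "\<And>Y q. (Y, q) \<in> E - {(X, p)} \<Longrightarrow> (n \<^bold>\<in> Y) r'"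
    show "\<not> (n \<^bold>\<in> X) r'"
    proof
      assume "(n \<^bold>\<in> X) r'"
      then have "\<forall>Y q. (Y, q) \<in> E \<longrightarrow> (n \<^bold>\<in> Y) r'" using r'(3) by blast
      then show False using no r'(1,2) by blast
    qed
  next
    show "r \<preceq> q" if "(Y, q) \<in> E - {(X, p)}" for Y q using E(4) that by blast
    show "r \<preceq> p" using E(4) in_E by blast
  qed (use E in auto)
qed

text \<open>
  The form in which maximality is used: if below \<open>p\<close> the set \<open>X\<close> contains a finite intersection of
  promised sets, then \<open>X\<close> is promised. The finite set may depend on the extension \<open>r\<close> of \<open>p\<close>.
\<close>

lemma maximal_fip_memI:
  assumes F: "maximal_fip F" and X: "X \<in> names" "p \<in> P"
    and ex: "\<And>r. r \<in> P \<Longrightarrow> r \<preceq> p \<Longrightarrow> \<exists>r0\<in>P. r0 \<preceq> r \<and> (\<exists>E0. finite E0 \<and> E0 \<subseteq> F \<and> (\<forall>Y q. (Y, q) \<in> E0 \<longrightarrow> r0 \<preceq> q) \<and>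
          (\<forall>r'\<in>P. \<forall>n. r' \<preceq> r0 \<longrightarrow> (\<forall>Y q. (Y, q) \<in> E0 \<longrightarrow> (n \<^bold>\<in> Y) r') \<longrightarrow> (n \<^bold>\<in> X) r'))"
  shows "(X, p) \<in> F"
proof (rule ccontr)
  assume "(X, p) \<notin> F"
  with F X obtain E r where E: "finite E" "E \<subseteq> F" "r \<in> P" "r \<preceq> p" "\<And>Y q. (Y, q) \<in> E \<Longrightarrow> r \<preceq> q"
    and no: "\<And>r' n. r' \<in> P \<Longrightarrow> r' \<preceq> r \<Longrightarrow> (\<And>Y q. (Y, q) \<in> E \<Longrightarrow> (n \<^bold>\<in> Y) r') \<Longrightarrow> \<not> (n \<^bold>\<in> X) r'"
    using maximal_fip_obstruction by metis
  obtain r0 E0 where r0: "r0 \<in> P" "r0 \<preceq> r" and E0: "finite E0" "E0 \<subseteq> F" "\<forall>Y q. (Y, q) \<in> E0 \<longrightarrow> r0 \<preceq> q"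
    and sub: "\<And>r' n. r' \<in> P \<Longrightarrow> r' \<preceq> r0 \<Longrightarrow> (\<forall>Y q. (Y, q) \<in> E0 \<longrightarrow> (n \<^bold>\<in> Y) r') \<Longrightarrow> (n \<^bold>\<in> X) r'"
    using ex[OF E(3,4)] by meson
  have fam: "F \<subseteq> names \<times> P" and fip: "has_fip F"
    using F by (auto simp: maximal_fip_def family_names_def)
  have "r0 \<preceq> q" if "(Y, q) \<in> E \<union> E0" for Y q
  proof (cases "(Y, q) \<in> E")
    case True
    then show ?thesis using E(2,3,5) fam r0 le_trans by blast
  next
    case False
    then show ?thesis using that E0(3) by blast
  qed
  then obtain r' n where r': "r' \<in> P" "r' \<preceq> r0" "\<And>Y q. (Y, q) \<in> E \<union> E0 \<Longrightarrow> (n \<^bold>\<in> Y) r'"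
    using has_fipD[OF fip, of "E \<union> E0" r0] E(1,2) E0(1,2) r0(1) by blast
  have "(n \<^bold>\<in> X) r'" using sub r' by blast
  moreover have "r' \<preceq> r" using r' r0 E(3) le_trans by blast
  ultimately show False using no[of r' n] r' by blast
qed

lemma maximal_fip_forces_mem_iff:
  assumes F: "maximal_fip F" and X: "X \<in> names" "p \<in> P"
  shows "(X \<^bold>\<in>\<^bold>\<in> F) p \<longleftrightarrow> (X, p) \<in> F"
proof
  assume "(X, p) \<in> F"
  then show "(X \<^bold>\<in>\<^bold>\<in> F) p"
    unfolding family_mem_def dense_below_def using X(2) le_refl eq_refl by blast
next
  assume mem: "(X \<^bold>\<in>\<^bold>\<in> F) p"
  show "(X, p) \<in> F"
  proof (rule maximal_fip_memI[OF F X])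
    fix r assume "r \<in> P" "r \<preceq> p"
    then obtain q \<tau> t where q: "q \<in> P" "q \<preceq> r" "(\<tau>, t) \<in> F" "q \<preceq> t" "(X \<^bold>= \<tau>) q"
      using mem unfolding family_mem_def dense_below_def by blast
    show "\<exists>r0\<in>P. r0 \<preceq> r \<and> (\<exists>E0. finite E0 \<and> E0 \<subseteq> F \<and> (\<forall>Y q. (Y, q) \<in> E0 \<longrightarrow> r0 \<preceq> q) \<and>
          (\<forall>r'\<in>P. \<forall>n. r' \<preceq> r0 \<longrightarrow> (\<forall>Y q. (Y, q) \<in> E0 \<longrightarrow> (n \<^bold>\<in> Y) r') \<longrightarrow> (n \<^bold>\<in> X) r'))"
      using q eq_memD[OF q(5)] by (intro bexI[of _ q] conjI exI[of _ "{(\<tau>, t)}"]) auto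
  qed
qed

text \<open>
  The closure properties of a filter need only the case in which one finite set of promises serves
  all extensions of \<open>p\<close>.
\<close>

lemma maximal_fip_superset:
  assumes F: "maximal_fip F" and X: "X \<in> names" "p \<in> P"
    and E: "finite E" "E \<subseteq> F" "\<And>Y q. (Y, q) \<in> E \<Longrightarrow> p \<preceq> q"
    and sub: "\<And>r n. r \<in> P \<Longrightarrow> r \<preceq> p \<Longrightarrow> (\<And>Y q. (Y, q) \<in> E \<Longrightarrow> (n \<^bold>\<in> Y) r) \<Longrightarrow> (n \<^bold>\<in> X) r"
  shows "(X, p) \<in> F"
proof (rule maximal_fip_memI[OF F X])
  fix r assume r: "r \<in> P" "r \<preceq> p"
  have "q \<in> P" if "(Y, q) \<in> E" for Y q
    using F E(2) that by (auto simp: maximal_fip_def family_names_def)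
  then have "r \<preceq> q" if "(Y, q) \<in> E" for Y q using E(3) r X(2) le_trans that by blast
  moreover have "(n \<^bold>\<in> X) r'" if "r' \<in> P" "r' \<preceq> r" "\<forall>Y q. (Y, q) \<in> E \<longrightarrow> (n \<^bold>\<in> Y) r'" for r' n
  proof (rule sub)
    show "r' \<preceq> p" using that r X(2) le_trans by blast
  qed (use that in auto)
  ultimately show "\<exists>r0\<in>P. r0 \<preceq> r \<and> (\<exists>E0. finite E0 \<and> E0 \<subseteq> F \<and> (\<forall>Y q. (Y, q) \<in> E0 \<longrightarrow> r0 \<preceq> q) \<and>
          (\<forall>r'\<in>P. \<forall>n. r' \<preceq> r0 \<longrightarrow> (\<forall>Y q. (Y, q) \<in> E0 \<longrightarrow> (n \<^bold>\<in> Y) r') \<longrightarrow> (n \<^bold>\<in> X) r'))"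
    using r E(1,2) le_refl by (intro bexI[of _ r] conjI exI[of _ E]) auto
qed

text \<open>
  If neither \<open>X\<close> nor a set \<open>Y\<close> containing its complement were promised below \<open>p\<close>, there would be
  obstructions to both of them, the second one found below the first. The promises occurring in the
  two obstructions together can be met, and a condition that decides whether the meeting point lies
  in \<open>X\<close> contradicts one of them.
\<close>

lemma maximal_fip_decides:
  assumes F: "maximal_fip F" and X: "X \<in> names" and Y: "Y \<in> names" and p: "p \<in> P"
    and compl: "\<And>r n. r \<in> P \<Longrightarrow> r \<preceq> p \<Longrightarrow> fNot (n \<^bold>\<in> X) r \<Longrightarrow> (n \<^bold>\<in> Y) r"
  shows "\<exists>q\<in>P. q \<preceq> p \<and> ((X, q) \<in> F \<or> (Y, q) \<in> F)"
proof (rule ccontr)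
  assume none: "\<not> ?thesis"
  then have "(X, p) \<notin> F" using p le_refl by blast
  with F X p obtain E1 r1 where E1: "finite E1" "E1 \<subseteq> F" "r1 \<in> P" "r1 \<preceq> p"
      "\<And>Z q. (Z, q) \<in> E1 \<Longrightarrow> r1 \<preceq> q"
    and no1: "\<And>r' n. r' \<in> P \<Longrightarrow> r' \<preceq> r1 \<Longrightarrow> (\<And>Z q. (Z, q) \<in> E1 \<Longrightarrow> (n \<^bold>\<in> Z) r') \<Longrightarrow> \<not> (n \<^bold>\<in> X) r'"
    using maximal_fip_obstruction by metis
  have "(Y, r1) \<notin> F" using none E1(3,4) by blast
  with F Y E1(3) obtain E2 r2 where E2: "finite E2" "E2 \<subseteq> F" "r2 \<in> P" "r2 \<preceq> r1"
      "\<And>Z q. (Z, q) \<in> E2 \<Longrightarrow> r2 \<preceq> q"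
    and no2: "\<And>r' n. r' \<in> P \<Longrightarrow> r' \<preceq> r2 \<Longrightarrow> (\<And>Z q. (Z, q) \<in> E2 \<Longrightarrow> (n \<^bold>\<in> Z) r') \<Longrightarrow> \<not> (n \<^bold>\<in> Y) r'"
    using maximal_fip_obstruction by metis
  have fam: "F \<subseteq> names \<times> P" and fip: "has_fip F"
    using F by (auto simp: maximal_fip_def family_names_def)
  have "r2 \<preceq> q" if "(Z, q) \<in> E1 \<union> E2" for Z q
  proof (cases "(Z, q) \<in> E2")
    case True
    then show ?thesis using E2(5) by blast
  next
    case False
    then have "(Z, q) \<in> E1" using that by blast
    then show ?thesis using E1(2,3,5) E2(3,4) fam le_trans by blast
  qed
  then obtain r n where r: "r \<in> P" "r \<preceq> r2" "\<And>Z q. (Z, q) \<in> E1 \<union> E2 \<Longrightarrow> (n \<^bold>\<in> Z) r"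
    using has_fipD[OF fip, of "E1 \<union> E2" r2] E1(1,2) E2(1-3) by blast
  have r_r1: "r \<preceq> r1" using r(1,2) E1(3) E2(3,4) le_trans by blast
  have not_X: "\<not> (n \<^bold>\<in> X) t" if t: "t \<in> P" "t \<preceq> r" for t
  proof (rule no1)
    show "t \<preceq> r1" using t r(1) r_r1 E1(3) le_trans by blast
    show "(n \<^bold>\<in> Z) t" if "(Z, q) \<in> E1" for Z q
      using mem_mono[OF r(3) t(2) r(1) t(1)] that by blast
  qed (rule t(1))
  have "r \<preceq> p" using r(1) r_r1 E1(3,4) p le_trans by blast
  then have "(n \<^bold>\<in> Y) r" using compl r(1) not_X unfolding fNot_def by blast
  then show False using no2[of r n] r by blast
qed

lemma maximal_fip_is_ultrafilter:
  assumes F: "maximal_fip F"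
  shows "forced (is_ultrafilter F)"
proof -
  have fip: "has_fip F" using F by (simp add: maximal_fip_def)
  note mem_iff = maximal_fip_forces_mem_iff[OF F]
  have whole: "(X \<^bold>\<in>\<^bold>\<in> F) p" if "X \<in> names" "p \<in> P" "fAll UNIV (\<lambda>n. n \<^bold>\<in> X) p" for X p
  proof -
    have "(X, p) \<in> F"
      by (rule maximal_fip_superset[OF F that(1,2), of "{}"])
        (use that in \<open>auto simp: fAll_def intro: mem_mono[where p = p]\<close>)
    then show ?thesis using mem_iff that by blast
  qed
  have empty: "\<not> (X \<^bold>\<in>\<^bold>\<in> F) p" if "X \<in> names" "p \<in> P" "fAll UNIV (\<lambda>n. fNot (n \<^bold>\<in> X)) p" for X p
  proof
    assume "(X \<^bold>\<in>\<^bold>\<in> F) p"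
    then have "(X, p) \<in> F" using mem_iff that by blast
    then have "\<exists>r\<in>P. \<exists>n. r \<preceq> p \<and> (n \<^bold>\<in> X) r"
      using has_fip_singleton[OF fip _ that(2)] by blast
    then show False using that(3) unfolding fAll_def fNot_def by blast
  qed
  have superset: "(Y \<^bold>\<in>\<^bold>\<in> F) p"
    if "X \<in> names" "Y \<in> names" "p \<in> P" "(X \<^bold>\<in>\<^bold>\<in> F) p" "fAll UNIV (\<lambda>n. n \<^bold>\<in> X \<^bold>\<longrightarrow> n \<^bold>\<in> Y) p" for X Y p
  proof -
    have "(X, p) \<in> F" using mem_iff that by blast
    then have "(Y, p) \<in> F"
      by (intro maximal_fip_superset[OF F that(2,3), of "{(X, p)}"])
        (use that le_refl in \<open>auto simp: fAll_def fImp_def\<close>)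
    then show ?thesis using mem_iff that by blast
  qed
  have inter: "(Z \<^bold>\<in>\<^bold>\<in> F) p"
    if "X \<in> names" "Y \<in> names" "Z \<in> names" "p \<in> P" "(X \<^bold>\<in>\<^bold>\<in> F) p" "(Y \<^bold>\<in>\<^bold>\<in> F) p"
      "fAll UNIV (\<lambda>n. n \<^bold>\<in> Z \<^bold>\<longleftrightarrow> n \<^bold>\<in> X \<^bold>\<and> n \<^bold>\<in> Y) p" for X Y Z p
  proof -
    have "(n \<^bold>\<in> Z) r" if "r \<in> P" "r \<preceq> p" "(n \<^bold>\<in> X) r" "(n \<^bold>\<in> Y) r" for n r
      using that \<open>fAll UNIV _ p\<close> unfolding fAll_def fImp_def fIff_def fAnd_def by blast
    moreover have "(X, p) \<in> F" "(Y, p) \<in> F" using mem_iff that by blast+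
    ultimately have "(Z, p) \<in> F"
      by (intro maximal_fip_superset[OF F that(3,4), of "{(X, p), (Y, p)}"])
        (use that(4) le_refl in auto)
    then show ?thesis using mem_iff that by blast
  qed
  have ultra: "(X \<^bold>\<in>\<^bold>\<in> F \<^bold>\<or> Y \<^bold>\<in>\<^bold>\<in> F) p"
    if "X \<in> names" "Y \<in> names" "p \<in> P" "fAll UNIV (\<lambda>n. n \<^bold>\<in> Y \<^bold>\<longleftrightarrow> fNot (n \<^bold>\<in> X)) p" for X Y p
    unfolding fOr_def dense_below_def
  proof (intro ballI impI)
    fix q assume q: "q \<in> P" "q \<preceq> p"
    have "(n \<^bold>\<in> Y) r" if "r \<in> P" "r \<preceq> q" "fNot (n \<^bold>\<in> X) r" for r n
    proof -
      have "r \<preceq> p" using that q \<open>p \<in> P\<close> le_trans by blast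
      then show ?thesis
        using that \<open>fAll UNIV (\<lambda>n. n \<^bold>\<in> Y \<^bold>\<longleftrightarrow> fNot (n \<^bold>\<in> X)) p\<close>
        unfolding fAll_def fImp_def fIff_def fAnd_def by blast
    qed
    then have "\<exists>r\<in>P. r \<preceq> q \<and> ((X, r) \<in> F \<or> (Y, r) \<in> F)"
      by (intro maximal_fip_decides[OF F that(1,2) q(1)])
    then show "\<exists>r\<in>P. r \<preceq> q \<and> r \<in> {q. (X \<^bold>\<in>\<^bold>\<in> F) q \<or> (Y \<^bold>\<in>\<^bold>\<in> F) q}"
      using mem_iff that(1,2) by blast
  qed
  have "is_ultrafilter F p" if "p \<in> P" for p
    unfolding is_ultrafilter_def fAnd_def[of "fAll _ _"]
  proof (intro conjI)
    show "fAll names (\<lambda>X. fAll UNIV (\<lambda>n. n \<^bold>\<in> X) \<^bold>\<longrightarrow> X \<^bold>\<in>\<^bold>\<in> F) p"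
      using whole by (simp add: fAll_def fImp_def)
    show "fAll names (\<lambda>X. fAll UNIV (\<lambda>n. fNot (n \<^bold>\<in> X)) \<^bold>\<longrightarrow> fNot (X \<^bold>\<in>\<^bold>\<in> F)) p"
      unfolding fAll_def[of names] fImp_def fNot_def[of "_ \<^bold>\<in>\<^bold>\<in> _"]
    proof (intro ballI impI)
      fix X :: "(nat, 'p) name" and q r
      assume *: "X \<in> names" "q \<in> P" "fAll UNIV (\<lambda>n. fNot (n \<^bold>\<in> X)) q" "r \<in> P" "r \<preceq> q"
      have "fAll UNIV (\<lambda>n. fNot (n \<^bold>\<in> X)) r"
        using * le_trans unfolding fAll_def fNot_def by blast
      then show "\<not> (X \<^bold>\<in>\<^bold>\<in> F) r" using empty * by blast
    qed
    show "fAll names (\<lambda>X. fAll names (\<lambda>Y.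
        X \<^bold>\<in>\<^bold>\<in> F \<^bold>\<and> fAll UNIV (\<lambda>n. n \<^bold>\<in> X \<^bold>\<longrightarrow> n \<^bold>\<in> Y) \<^bold>\<longrightarrow> Y \<^bold>\<in>\<^bold>\<in> F)) p"
      unfolding fAll_def[of names] fImp_def[of "_ \<^bold>\<and> _"]
      unfolding fAnd_def
    proof (intro ballI impI, elim conjE)
      fix X Y :: "(nat, 'p) name" and q
      assume "X \<in> names" "Y \<in> names" "q \<in> P" "(X \<^bold>\<in>\<^bold>\<in> F) q"
        "fAll UNIV (\<lambda>n. n \<^bold>\<in> X \<^bold>\<longrightarrow> n \<^bold>\<in> Y) q"
      then show "(Y \<^bold>\<in>\<^bold>\<in> F) q" by (rule superset)
    qed
    show "fAll names (\<lambda>X. fAll names (\<lambda>Y. fAll names (\<lambda>Z.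
        X \<^bold>\<in>\<^bold>\<in> F \<^bold>\<and> Y \<^bold>\<in>\<^bold>\<in> F \<^bold>\<and> fAll UNIV (\<lambda>n. n \<^bold>\<in> Z \<^bold>\<longleftrightarrow> n \<^bold>\<in> X \<^bold>\<and> n \<^bold>\<in> Y)
          \<^bold>\<longrightarrow> Z \<^bold>\<in>\<^bold>\<in> F))) p"
      unfolding fAll_def[of names] fImp_def[of "_ \<^bold>\<in>\<^bold>\<in> _ \<^bold>\<and> _"]
      unfolding fAnd_def[of "_ \<^bold>\<in>\<^bold>\<in> _"]
    proof (intro ballI impI, elim conjE)
      fix X Y Z :: "(nat, 'p) name" and q
      assume "X \<in> names" "Y \<in> names" "Z \<in> names" "q \<in> P" "(X \<^bold>\<in>\<^bold>\<in> F) q" "(Y \<^bold>\<in>\<^bold>\<in> F) q"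
        "fAll UNIV (\<lambda>n. n \<^bold>\<in> Z \<^bold>\<longleftrightarrow> n \<^bold>\<in> X \<^bold>\<and> n \<^bold>\<in> Y) q"
      then show "(Z \<^bold>\<in>\<^bold>\<in> F) q" by (rule inter)
    qed
    show "fAll names (\<lambda>X. fAll names (\<lambda>Y.
        fAll UNIV (\<lambda>n. n \<^bold>\<in> Y \<^bold>\<longleftrightarrow> fNot (n \<^bold>\<in> X)) \<^bold>\<longrightarrow> X \<^bold>\<in>\<^bold>\<in> F \<^bold>\<or> Y \<^bold>\<in>\<^bold>\<in> F)) p"
      unfolding fAll_def[of names] fImp_def[of "fAll _ _"] using ultra by blast
  qed
  then show ?thesis unfolding forced_def forces_def by blast
qed

section \<open>A combinatorial criterion for linkedness\<close>

lemma card_interval: "card (interval k) = 2 ^ k"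
  by (simp add: interval_def)

lemma finite_interval: "finite (interval k)"
  by (simp add: interval_def)

lemma decide_finite:
  assumes "finite I" "p \<in> P"
  shows "\<exists>u\<in>P. u \<preceq> p \<and> (\<forall>l\<in>I. (q l \<^bold>\<in> \<sigma>) u \<or> fNot (q l \<^bold>\<in> \<sigma>) u)"
  using assms(1)
proof induction
  case empty
  then show ?case using assms(2) le_refl by blast
next
  case (insert x I)
  then obtain u where u: "u \<in> P" "u \<preceq> p" "\<forall>l\<in>I. (q l \<^bold>\<in> \<sigma>) u \<or> fNot (q l \<^bold>\<in> \<sigma>) u" by blast
  obtain v where v: "v \<in> P" "v \<preceq> u" "(q x \<^bold>\<in> \<sigma>) v \<or> fNot (q x \<^bold>\<in> \<sigma>) v"
    using u(1) le_refl unfolding fNot_def by blast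
  have "v \<preceq> p" using u v assms(2) le_trans by blast
  moreover have "(q l \<^bold>\<in> \<sigma>) v \<or> fNot (q l \<^bold>\<in> \<sigma>) v" if "l \<in> I" for l
    using u(3) that
    by (blast intro: mem_mono[OF _ v(2) u(1) v(1)] fNot_mono[OF _ v(2) u(1) v(1)])
  ultimately show ?case using v by blast
qed

text \<open>
  The density is not decided by a condition that merely lies below many of the \<open>q l\<close>, as further
  \<open>q l\<close> may enter the generic filter. A condition that decides \<open>q l \<in> G\<close> for all \<open>l\<close> in the interval
  decides it, and then the \<open>l\<close> with a positive decision include the given ones.
\<close>

lemma density_geI:
  assumes p: "p \<in> P" and q: "\<And>l. q l \<in> P" and H: "H \<subseteq> interval k" "\<And>l. l \<in> H \<Longrightarrow> p \<preceq> q l"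
    and card: "c * 2 ^ k \<le> of_nat (card H)"
  shows "density_ge q k c p"
  unfolding density_ge_def fEx_def dense_below_def
proof (intro ballI impI)
  fix t assume t: "t \<in> P" "t \<preceq> p"
  obtain u where u: "u \<in> P" "u \<preceq> t"
    and dec: "\<And>l. l \<in> interval k \<Longrightarrow> (q l \<^bold>\<in> generic_name) u \<or> fNot (q l \<^bold>\<in> generic_name) u"
    using decide_finite[OF finite_interval t(1)] by blast
  define S where "S = {l \<in> interval k. (q l \<^bold>\<in> generic_name) u}"
  have u_p: "u \<preceq> p" using u t p le_trans by blast
  have "H \<subseteq> S"
  proof
    fix l assume l: "l \<in> H"
    have "u \<preceq> q l" using H(2)[OF l] u_p u(1) p q le_trans by blast
    then have "(q l \<^bold>\<in> generic_name) u"
      using u(1) q by (intro memI[where r = "q l"]) (auto simp: generic_name_def)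
    then show "l \<in> S" using l H(1) by (auto simp: S_def)
  qed
  then have "card H \<le> card S"
    by (intro card_mono) (auto simp: S_def finite_interval)
  then have "c * 2 ^ k \<le> of_nat (card S)"
    using card by (meson of_nat_le_iff order_trans)
  then have x: "c \<le> of_nat (card S) / of_nat (card (interval k))"
    by (simp add: card_interval field_simps)
  have eq: "(hits q k \<^bold>= check S) v" if v: "v \<in> P" "v \<preceq> u" for v
    unfolding eq_def fAll_def fIff_def fAnd_def fImp_def
  proof (intro ballI conjI impI)
    fix a w assume w: "w \<in> P" "w \<preceq> v" and a: "(a \<^bold>\<in> hits q k) w"
    have w_u: "w \<preceq> u" using w v u le_trans by blast
    obtain z r where z: "z \<in> P" "z \<preceq> w" "r \<in> P" "(a, r) \<in> hits q k" "z \<preceq> r"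
      using a w le_refl unfolding mem_def dense_below_def by blast
    have ar: "a \<in> interval k" "(q a \<^bold>\<in> generic_name) r"
      using z(4) by (auto simp: hits_def comprehension_def forces_def)
    have "(q a \<^bold>\<in> generic_name) z" by (rule mem_mono[OF ar(2) z(5,3,1)])
    moreover have "z \<preceq> u" using z w_u w u le_trans by blast
    ultimately have "\<not> fNot (q a \<^bold>\<in> generic_name) u" using z(1) unfolding fNot_def by blast
    then have "a \<in> S" using dec ar(1) by (auto simp: S_def)
    then show "(a \<^bold>\<in> check S) w" by (simp add: mem_check_iff[OF w(1)])
  next
    fix a w assume w: "w \<in> P" "w \<preceq> v" and a: "(a \<^bold>\<in> check S) w"
    have "a \<in> S" using a by (simp add: mem_check_iff[OF w(1)])
    moreover have "w \<preceq> u" using w v u le_trans by blast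
    ultimately have "a \<in> interval k" "(q a \<^bold>\<in> generic_name) w"
      by (auto simp: S_def intro: mem_mono[where p = u] u w)
    then show "(a \<^bold>\<in> hits q k) w" unfolding hits_def using w by (intro mem_comprehensionI) auto
  qed
  let ?x = "of_nat (card S) / of_nat (card (interval k)) :: rat"
  have "(?x \<^bold>\<in> density q k) u"
    unfolding density_def
  proof (rule mem_comprehensionI)
    show "fEx {T. T \<subseteq> interval k \<and> ?x = of_nat (card T) / of_nat (card (interval k))}
            (\<lambda>T. hits q k \<^bold>= check T) u"
      unfolding fEx_def dense_below_def
    proof (intro ballI impI)
      fix v assume "v \<in> P" "v \<preceq> u"
      moreover have "S \<subseteq> interval k" by (auto simp: S_def)
      ultimately show "\<exists>r\<in>P. r \<preceq> v \<and> r \<in> {q'. \<exists>T\<in>{T. T \<subseteq> interval k \<and>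
          ?x = of_nat (card T) / of_nat (card (interval k))}. (hits q k \<^bold>= check T) q'}"
        using eq le_refl by blast
    qed
  qed (rule u)
  then show "\<exists>r\<in>P. r \<preceq> t \<and> r \<in> {q'. \<exists>x\<in>{x. c \<le> x}. (x \<^bold>\<in> density q k) q'}"
    using u x by blast
qed

lemma ultrafilter_member_nonempty:
  assumes "ultrafilter D" "X \<in> D"
  shows "\<exists>j. j \<in> X"
  using assms unfolding ultrafilter_def by (cases "X = {}") auto

lemma ultrafilter_superset:
  assumes "ultrafilter D" "X \<in> D" "X \<subseteq> Y"
  shows "Y \<in> D"
  using assms unfolding ultrafilter_def by blast

lemma ultrafilter_Int:
  assumes "ultrafilter D" "X \<in> D" "Y \<in> D"
  shows "X \<inter> Y \<in> D"
  using assms unfolding ultrafilter_def by blast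

lemma ultrafilter_finite_Inter:
  assumes "ultrafilter D" "finite I" "\<And>i. i \<in> I \<Longrightarrow> X i \<in> D"
  shows "{j. \<forall>i\<in>I. j \<in> X i} \<in> D"
  using assms(2,3)
proof induction
  case empty
  then show ?case using assms(1) by (simp add: ultrafilter_def)
next
  case (insert i I)
  have "{j. \<forall>i\<in>insert i I. j \<in> X i} = X i \<inter> {j. \<forall>i\<in>I. j \<in> X i}" by auto
  then show ?case using insert assms(1) by (simp add: ultrafilter_def)
qed

text \<open>
  The ultrafilter is generated by the promises that every condition makes for the sets in \<open>D\<close> and
  that \<open>limit q\<close> makes for the set of \<open>k\<close> at which \<open>q\<close> has high density. The last hypothesis is the
  finite intersection property of these promises; finitely many sets in \<open>D\<close> amount to a single \<open>A\<close>.
\<close>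

lemma lim_linkedI:
  assumes D: "ultrafilter D" and Q: "Q \<subseteq> P" and limit: "limit \<in> (UNIV \<rightarrow> Q) \<rightarrow> P"
    and key: "\<And>r E A. r \<in> P \<Longrightarrow> finite E \<Longrightarrow> E \<subseteq> UNIV \<rightarrow> Q \<Longrightarrow> (\<And>q. q \<in> E \<Longrightarrow> r \<preceq> limit q) \<Longrightarrow> A \<in> D \<Longrightarrow>
      \<exists>k\<in>A. \<exists>H. (\<forall>q\<in>E. H q \<subseteq> interval k \<and> (1 - \<epsilon>) * 2 ^ k \<le> of_nat (card (H q))) \<and>
        (\<exists>r'\<in>P. r' \<preceq> r \<and> (\<forall>q\<in>E. \<forall>l\<in>H q. r' \<preceq> q l))"
  shows "lim_linked D \<epsilon> Q"
proof -
  define N where "N q = comprehension (\<lambda>k. density_ge q k (1 - \<epsilon>))" for q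
  define F0 where "F0 = check ` D \<times> P \<union> {(N q, limit q) | q. q \<in> UNIV \<rightarrow> Q}"
  have check_name: "check A \<in> names" for A :: "nat set" by (auto simp: check_def names_def)
  have fam: "F0 \<in> family_names"
    using limit check_name comprehension_in_names
    by (auto simp: F0_def family_names_def N_def)
  have fip: "has_fip F0"
    unfolding has_fip_def
  proof (intro allI impI)
    fix E r assume E: "finite E" "E \<subseteq> F0" and r: "r \<in> P" "\<forall>X p. (X, p) \<in> E \<longrightarrow> r \<preceq> p"
    have "\<exists>A q. (A \<in> D \<and> fst e = check A) \<or> (q \<in> UNIV \<rightarrow> Q \<and> e = (N q, limit q))" if "e \<in> E" for e
      using E(2) that by (force simp: F0_def)
    then obtain a g where ag: "\<And>e. e \<in> E \<Longrightarrow> (a e \<in> D \<and> fst e = check (a e)) \<or>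
        (g e \<in> UNIV \<rightarrow> Q \<and> e = (N (g e), limit (g e)))"
      by metis
    define E1 where "E1 = {e \<in> E. a e \<in> D \<and> fst e = check (a e)}"
    define E2 where "E2 = {e \<in> E. g e \<in> UNIV \<rightarrow> Q \<and> e = (N (g e), limit (g e))}"
    define A where "A = {j. \<forall>e\<in>E1. j \<in> a e}"
    define G where "G = g ` E2"
    have A: "A \<in> D"
      unfolding A_def by (rule ultrafilter_finite_Inter[OF D]) (use E(1) in \<open>auto simp: E1_def\<close>)
    have "r \<preceq> limit q" if "q \<in> G" for q
      using that r(2) by (auto simp: G_def E2_def)
    moreover have "G \<subseteq> UNIV \<rightarrow> Q" by (auto simp: G_def E2_def)
    moreover have "finite G" using E(1) by (auto simp: G_def E2_def)
    ultimately have "\<exists>k\<in>A. \<exists>H. (\<forall>q\<in>G. H q \<subseteq> interval k \<and> (1 - \<epsilon>) * 2 ^ k \<le> of_nat (card (H q))) \<and>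
        (\<exists>r'\<in>P. r' \<preceq> r \<and> (\<forall>q\<in>G. \<forall>l\<in>H q. r' \<preceq> q l))"
      using A by (intro key[OF r(1)])
    then obtain k H where k: "k \<in> A"
      and H: "\<forall>q\<in>G. H q \<subseteq> interval k \<and> (1 - \<epsilon>) * 2 ^ k \<le> of_nat (card (H q))"
      and "\<exists>r'\<in>P. r' \<preceq> r \<and> (\<forall>q\<in>G. \<forall>l\<in>H q. r' \<preceq> q l)"
      by (elim bexE[of A] exE conjE) (rule that)
    then obtain r' where r': "r' \<in> P" "r' \<preceq> r" and below: "\<forall>q\<in>G. \<forall>l\<in>H q. r' \<preceq> q l"
      by (elim bexE conjE) (rule that)
    have "(k \<^bold>\<in> X) r'" if e: "(X, p) \<in> E" for X p
    proof (cases "(X, p) \<in> E1")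
      case True
      then have "X = check (a (X, p))" "k \<in> a (X, p)" using k by (auto simp: A_def E1_def)
      then show ?thesis using r'(1) by (metis mem_check_iff)
    next
      case False
      then have "(X, p) \<in> E2" using ag[OF e] e by (auto simp: E1_def E2_def)
      then have q: "g (X, p) \<in> G" "g (X, p) \<in> UNIV \<rightarrow> Q" "X = N (g (X, p))"
        by (auto simp: G_def E2_def)
      have "density_ge (g (X, p)) k (1 - \<epsilon>) r'"
        using q(1,2) Q H below by (intro density_geI[OF r'(1), where H = "H (g (X, p))"]) auto
      then have "(k \<^bold>\<in> N (g (X, p))) r'" unfolding N_def using r'(1) by (intro mem_comprehensionI)
      then show ?thesis using q(3) by simp
    qed
    then show "\<exists>r'\<in>P. \<exists>n. r' \<preceq> r \<and> (\<forall>X p. (X, p) \<in> E \<longrightarrow> (n \<^bold>\<in> X) r')" using r' by blast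
  qed
  obtain M where M: "F0 \<subseteq> M" "maximal_fip M" using maximal_fip_exists[OF fam fip] by blast
  have forces: "(X \<^bold>\<in>\<^bold>\<in> M) p" if "(X, p) \<in> F0" for X p
    using that fam M maximal_fip_forces_mem_iff[OF M(2)] by (auto simp: family_names_def)
  have "ultrafilter_name_extending D M"
    unfolding ultrafilter_name_extending_def
  proof (intro conjI)
    show "M \<in> family_names" using M(2) by (simp add: maximal_fip_def)
    show "forced (is_ultrafilter M)" using maximal_fip_is_ultrafilter[OF M(2)] .
    show "forced (fAll D (\<lambda>A. check A \<^bold>\<in>\<^bold>\<in> M))"
      using forces by (auto simp: forced_def forces_def fAll_def F0_def)
  qed
  moreover have "limit q \<tturnstile> N q \<^bold>\<in>\<^bold>\<in> M" if "q \<in> UNIV \<rightarrow> Q" for q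
  proof -
    have "(N q, limit q) \<in> F0" using that by (auto simp: F0_def)
    then show ?thesis using forces that limit by (auto simp: forces_def)
  qed
  ultimately show ?thesis
    unfolding lim_linked_def N_def using Q limit by blast
qed

end

section \<open>Finite unions of slaloms\<close>

lemma slalom_bound_mono:
  assumes "slalom_bound b m k \<phi>" "m \<le> m'" "k \<le> k'"
  shows "slalom_bound b m' k' \<phi>"
  unfolding slalom_bound_def
proof (intro allI impI)
  fix n assume "m' \<le> n"
  then have "real (card (\<phi> n)) / real (b n) \<le> 2 powr (- (real n / 2 ^ k))"
    using assms by (simp add: slalom_bound_def)
  also have "\<dots> \<le> 2 powr (- (real n / 2 ^ k'))"
  proof -
    have "(2::real) ^ k \<le> 2 ^ k'" using assms(3) by simp
    then have "real n / 2 ^ k' \<le> real n / 2 ^ k" by (intro divide_left_mono) auto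
    then show ?thesis by simp
  qed
  finally show "real (card (\<phi> n)) / real (b n) \<le> 2 powr (- (real n / 2 ^ k'))" .
qed

text \<open>
  Doubling is absorbed by passing from \<open>k\<close> to \<open>k + 1\<close>, as \<open>2 * x\<^sup>2 \<le> x\<close> for \<open>x = 2\<^bsup>-n/2^(k+1)\<^esup> \<le> 1/2\<close>.
\<close>

lemma slalom_bound_Un:
  assumes "slalom_bound b m k \<phi>" "slalom_bound b m k \<psi>" "2 ^ Suc k \<le> m"
  shows "slalom_bound b m (Suc k) (\<lambda>n. \<phi> n \<union> \<psi> n)"
  unfolding slalom_bound_def
proof (intro allI impI)
  fix n assume n: "m \<le> n"
  let ?y = "real n / 2 ^ Suc k"
  have "2 ^ Suc k \<le> n" using n assms(3) by simp
  then have "real (2 ^ Suc k) \<le> real n" by (simp only: of_nat_le_iff)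
  then have y: "1 \<le> ?y" by simp
  have "real (card (\<phi> n \<union> \<psi> n)) \<le> real (card (\<phi> n)) + real (card (\<psi> n))"
    using card_Un_le[of "\<phi> n" "\<psi> n"] by linarith
  then have "real (card (\<phi> n \<union> \<psi> n)) / real (b n)
      \<le> real (card (\<phi> n)) / real (b n) + real (card (\<psi> n)) / real (b n)"
    by (simp add: add_divide_distrib[symmetric] divide_right_mono)
  also have "\<dots> \<le> 2 powr (- (real n / 2 ^ k)) + 2 powr (- (real n / 2 ^ k))"
    using assms(1,2) n unfolding slalom_bound_def by (intro add_mono) blast+
  also have "\<dots> = 2 * 2 powr (- (real n / 2 ^ k))" by simp
  also have "\<dots> = 2 powr (1 + - (real n / 2 ^ k))" by (simp only: powr_add) simp
  also have "\<dots> \<le> 2 powr (- ?y)"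
  proof -
    have "real n / 2 ^ k = 2 * ?y" by simp
    then have "1 + - (real n / 2 ^ k) \<le> - ?y" using y by linarith
    then show ?thesis by (simp only: powr_le_cancel_iff one_less_numeral_iff semiring_norm)
  qed
  finally show "real (card (\<phi> n \<union> \<psi> n)) / real (b n) \<le> 2 powr (- ?y)" .
qed

lemma slalom_bound_UN:
  assumes "finite F" "\<And>\<phi>. \<phi> \<in> F \<Longrightarrow> \<exists>m k. slalom_bound b m k \<phi>"
  shows "\<exists>m k. slalom_bound b m k (\<lambda>n. \<Union>\<phi>\<in>F. \<phi> n)"
  using assms
proof induction
  case empty
  then show ?case by (simp add: slalom_bound_def)
next
  case (insert \<phi> F)
  obtain m k where 1: "slalom_bound b m k \<phi>" using insert.prems by blast
  obtain m' k' where 2: "slalom_bound b m' k' (\<lambda>n. \<Union>\<phi>\<in>F. \<phi> n)" using insert by blast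
  let ?k = "max k k'"
  let ?m = "max (max m m') (2 ^ Suc ?k)"
  have "slalom_bound b ?m (Suc ?k) (\<lambda>n. \<phi> n \<union> (\<Union>\<phi>\<in>F. \<phi> n))"
    by (intro slalom_bound_Un slalom_bound_mono[OF 1] slalom_bound_mono[OF 2]) auto
  then show ?case by auto
qed

section \<open>Limits of slaloms\<close>

lemma sum_inverse_consecutive:
  assumes "1 \<le> m" "m \<le> M"
  shows "(\<Sum>n=m..<M. 1 / (rat_of_nat n * (rat_of_nat n + 1))) = 1 / rat_of_nat m - 1 / rat_of_nat M"
  using assms(2)
proof (induction M rule: dec_induct)
  case base
  then show ?case by simp
next
  case (step M)
  have M: "rat_of_nat M \<noteq> 0" "rat_of_nat M + 1 \<noteq> 0"
    using step assms(1) by (auto simp flip: of_nat_Suc)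
  have "1 / (rat_of_nat M * (rat_of_nat M + 1)) = 1 / rat_of_nat M - 1 / rat_of_nat (Suc M)"
    using M by (simp add: divide_simps)
  then show ?case using step by simp
qed

text \<open>
  Half of the exponent in the bound pays for the factor \<open>n (n + 1)\<close>.
\<close>

lemma long_factor:
  assumes "long k d" "length d \<le> n"
  shows "real (n * (n + 1)) * 2 powr (- (real n / 2 ^ k)) \<le> 2 powr (- (real n / 2 ^ Suc k))"
proof -
  define x where "x = 2 powr (- (real n / 2 ^ Suc k))"
  define c where "c = real (n * (n + 1))"
  have x: "x > 0" by (simp add: x_def)
  have "0 < n * (n + 1)" using assms by (auto simp: long_def)
  then have c: "c > 0" by (simp only: c_def of_nat_0_less_iff)
  have xx: "2 powr (- (real n / 2 ^ k)) = x\<^sup>2"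
  proof -
    have "- (real n / 2 ^ k) = - (real n / 2 ^ Suc k) + - (real n / 2 ^ Suc k)" by simp
    then show ?thesis by (simp only: x_def power2_eq_square powr_add)
  qed
  have "x\<^sup>2 \<le> 1 / ((real n)\<^sup>2 * (real n + 1)\<^sup>2)"
    using assms xx by (metis long_def)
  also have "\<dots> = (1 / c)\<^sup>2"
  proof -
    have "c = real n * (real n + 1)" by (simp add: c_def algebra_simps)
    then show ?thesis by (simp only: power_divide power_mult_distrib power_one)
  qed
  finally have "x \<le> 1 / c" using c by (intro power2_le_imp_le[of x "1 / c"]) auto
  then have "c * x \<le> 1" using c by (simp add: field_simps)
  then have "c * x * x \<le> 1 * x" using x by (intro mult_right_mono) auto
  then show ?thesis unfolding xx by (fold x_def c_def) (simp add: power2_eq_square mult.assoc)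
qed

context forcing_poset
begin

text \<open>
  The threshold for the frequency of \<open>i\<close> in the \<open>j\<close>-th interval, which has \<open>2 ^ j\<close> elements, is
  \<open>1 / (n (n + 1))\<close>. Comparing the frequencies with it along \<open>D\<close> makes limits of real numbers
  unnecessary, and without division no \<open>i\<close> passes the test at \<open>n = 0\<close>.
\<close>

definition limit_slalom :: "nat set set \<Rightarrow> (nat \<Rightarrow> nat \<Rightarrow> nat set) \<Rightarrow> nat \<Rightarrow> nat set" where
  "limit_slalom D \<phi> n =
     {i. {j. 2 ^ j \<le> n * (n + 1) * card {l \<in> interval j. i \<in> \<phi> l n}} \<in> D}"

lemma limit_slalom_subset:
  assumes "ultrafilter D" "\<And>l. \<phi> l n \<subseteq> B"
  shows "limit_slalom D \<phi> n \<subseteq> B"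
proof
  fix i assume i: "i \<in> limit_slalom D \<phi> n"
  obtain j where "2 ^ j \<le> n * (n + 1) * card {l \<in> interval j. i \<in> \<phi> l n}"
    using i ultrafilter_member_nonempty[OF assms(1)] unfolding limit_slalom_def by blast
  then have "card {l \<in> interval j. i \<in> \<phi> l n} \<noteq> 0"
    by (metis mult_0_right not_le zero_less_numeral zero_less_power)
  then show "i \<in> B" using assms(2) by (auto simp: card_eq_0_iff)
qed

text \<open>
  A single interval witnesses the high frequency of all of the finitely many values in the limit at
  \<open>n\<close>. There the pairs \<open>(i, l)\<close> with \<open>i \<in> \<phi> l n\<close> are counted in two ways.
\<close>

lemma limit_slalom_bound:
  assumes D: "ultrafilter D" and d: "long k d" and b: "\<And>n. 0 < b n"
    and sub: "\<And>l n. \<phi> l n \<subseteq> {..<b n}"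
    and bound: "\<And>l. slalom_bound b (length d) k (\<phi> l)"
  shows "slalom_bound b (length d) (Suc k) (limit_slalom D \<phi>)"
  unfolding slalom_bound_def
proof (intro allI impI)
  fix n assume n: "length d \<le> n"
  define L where "L = limit_slalom D \<phi> n"
  define x where "x = 2 powr (- (real n / 2 ^ k))"
  have fin: "finite L"
    unfolding L_def by (rule finite_subset[OF limit_slalom_subset[OF D, where B = "{..<b n}"]]) (auto simp: sub)
  define J where "J i = {j. 2 ^ j \<le> n * (n + 1) * card {l \<in> interval j. i \<in> \<phi> l n}}" for i
  have "{j. \<forall>i\<in>L. j \<in> J i} \<in> D"
    by (rule ultrafilter_finite_Inter[OF D fin]) (simp add: L_def J_def limit_slalom_def)
  from ultrafilter_member_nonempty[OF D this] obtain j where "\<And>i. i \<in> L \<Longrightarrow> j \<in> J i" by blast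
  then have j: "2 ^ j \<le> n * (n + 1) * card {l \<in> interval j. i \<in> \<phi> l n}" if "i \<in> L" for i
    using that by (simp add: J_def)
  have "card L * 2 ^ j = (\<Sum>i\<in>L. 2 ^ j)" by simp
  also have "\<dots> \<le> (\<Sum>i\<in>L. n * (n + 1) * card {l \<in> interval j. i \<in> \<phi> l n})"
    by (rule sum_mono) (rule j)
  also have "\<dots> = n * (n + 1) * (\<Sum>i\<in>L. card {l \<in> interval j. i \<in> \<phi> l n})"
    by (simp only: sum_distrib_left)
  also have "(\<Sum>i\<in>L. card {l \<in> interval j. i \<in> \<phi> l n}) = (\<Sum>l\<in>interval j. card {i \<in> L. i \<in> \<phi> l n})"
    by (rule sum_multicount_gen) (auto simp: fin finite_interval)
  finally have "real (card L * 2 ^ j) \<le> real (n * (n + 1) * (\<Sum>l\<in>interval j. card {i \<in> L. i \<in> \<phi> l n}))"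
    by (simp only: of_nat_le_iff)
  also have "\<dots> = real (n * (n + 1)) * (\<Sum>l\<in>interval j. real (card {i \<in> L. i \<in> \<phi> l n}))"
    by (simp only: of_nat_mult of_nat_sum)
  also have "\<dots> \<le> real (n * (n + 1)) * (\<Sum>l\<in>interval j. real (b n) * x)"
  proof (intro mult_left_mono sum_mono)
    fix l
    have "card {i \<in> L. i \<in> \<phi> l n} \<le> card (\<phi> l n)"
      by (intro card_mono finite_subset[OF sub]) auto
    also have "real (card (\<phi> l n)) / real (b n) \<le> x"
      using bound n by (simp add: slalom_bound_def x_def)
    then have "real (card (\<phi> l n)) \<le> real (b n) * x"
      using b[of n] by (simp add: field_simps)
    finally show "real (card {i \<in> L. i \<in> \<phi> l n}) \<le> real (b n) * x" by simp
  qed simp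
  also have "\<dots> = (real (n * (n + 1)) * x) * (real (b n) * 2 ^ j)"
    by (simp add: card_interval)
  also have "\<dots> \<le> 2 powr (- (real n / 2 ^ Suc k)) * (real (b n) * 2 ^ j)"
    using long_factor[OF d n] by (intro mult_right_mono) (simp_all only: x_def, simp)
  finally have "real (card L) * 2 ^ j \<le> (2 powr (- (real n / 2 ^ Suc k)) * real (b n)) * 2 ^ j"
    by (simp only: of_nat_mult of_nat_power of_nat_numeral mult.assoc)
  then have "real (card L) \<le> 2 powr (- (real n / 2 ^ Suc k)) * real (b n)"
    by (rule mult_right_le_imp_le) simp
  then show "real (card (limit_slalom D \<phi> n)) / real (b n) \<le> 2 powr (- (real n / 2 ^ Suc k))"
    using b[of n] by (simp add: L_def divide_le_eq)
qed

text \<open>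
  Each single \<open>t n\<close> spoils a proportion of less than \<open>1 / (n (n + 1))\<close> of the \<open>l\<close> in \<open>D\<close>-many
  intervals, and these proportions add up to at most \<open>1 / m\<close>.
\<close>

lemma avoids_limit_slalom:
  assumes D: "ultrafilter D" and m: "1 \<le> m" and N: "finite N" "N \<subseteq> {m..}"
    and t: "\<And>n. n \<in> N \<Longrightarrow> t n \<notin> limit_slalom D \<phi> n"
  shows "{j. (1 - 1 / rat_of_nat m) * 2 ^ j
            \<le> of_nat (card {l \<in> interval j. \<forall>n\<in>N. t n \<notin> \<phi> l n})} \<in> D" (is "?R \<in> D")
proof -
  let ?B = "\<lambda>n j. {l \<in> interval j. t n \<in> \<phi> l n}"
  let ?low = "{j. \<forall>n\<in>N. j \<in> {j. n * (n + 1) * card (?B n j) < 2 ^ j}}"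
  have "?low \<in> D"
  proof (rule ultrafilter_finite_Inter[OF D N(1)])
    fix n assume "n \<in> N"
    then have "- {j. 2 ^ j \<le> n * (n + 1) * card (?B n j)} \<in> D"
      using t[of n] D unfolding limit_slalom_def ultrafilter_def by blast
    also have "- {j. 2 ^ j \<le> n * (n + 1) * card (?B n j)} = {j. n * (n + 1) * card (?B n j) < 2 ^ j}"
      by auto
    finally show "{j. n * (n + 1) * card (?B n j) < 2 ^ j} \<in> D" .
  qed
  moreover have "?low \<subseteq> ?R"
  proof
    fix j assume j: "j \<in> ?low"
    let ?H = "{l \<in> interval j. \<forall>n\<in>N. t n \<notin> \<phi> l n}"
    obtain M where M: "N \<subseteq> {m..<M}" "m \<le> M"
    proof -
      obtain M0 where "N \<subseteq> {..<M0}" using N(1) finite_nat_iff_bounded by blast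
      then have "N \<subseteq> {m..<max m M0}" using N(2) by fastforce
      then show thesis using that by (meson max.cobounded1)
    qed
    have B: "of_nat (card (?B n j)) \<le> (2::rat) ^ j * (1 / (rat_of_nat n * (rat_of_nat n + 1)))"
      if "n \<in> N" for n
    proof -
      define c where "c = rat_of_nat n * (rat_of_nat n + 1)"
      have "n * (n + 1) * card (?B n j) \<le> 2 ^ j" using j that by (simp add: less_imp_le)
      then have "rat_of_nat (n * (n + 1) * card (?B n j)) \<le> rat_of_nat (2 ^ j)"
        by (simp only: of_nat_le_iff)
      then have "c * of_nat (card (?B n j)) \<le> 2 ^ j"
        by (simp only: c_def of_nat_mult of_nat_add of_nat_1 of_nat_power of_nat_numeral)
      moreover have "0 < n" using that N(2) m by auto
      then have "0 < c" unfolding c_def by (intro mult_pos_pos add_pos_pos) auto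
      ultimately have "of_nat (card (?B n j)) \<le> 2 ^ j * (1 / c)"
        by (simp add: pos_le_divide_eq mult.commute)
      then show ?thesis by (simp only: c_def)
    qed
    have "interval j \<subseteq> ?H \<union> (\<Union>n\<in>N. ?B n j)" by auto
    then have "card (interval j) \<le> card (?H \<union> (\<Union>n\<in>N. ?B n j))"
      using N(1) by (intro card_mono) (auto simp: finite_interval)
    also have "\<dots> \<le> card ?H + card (\<Union>n\<in>N. ?B n j)" by (rule card_Un_le)
    also have "\<dots> \<le> card ?H + (\<Sum>n\<in>N. card (?B n j))" by (intro add_left_mono card_UN_le N(1))
    finally have "rat_of_nat (2 ^ j) \<le> rat_of_nat (card ?H + (\<Sum>n\<in>N. card (?B n j)))"
      by (simp only: of_nat_le_iff card_interval)
    also have "\<dots> = of_nat (card ?H) + (\<Sum>n\<in>N. of_nat (card (?B n j)))"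
      by (simp only: of_nat_add of_nat_sum)
    also have "(\<Sum>n\<in>N. of_nat (card (?B n j))) \<le> (\<Sum>n\<in>N. (2::rat) ^ j * (1 / (of_nat n * (of_nat n + 1))))"
      by (rule sum_mono) (rule B)
    also have "\<dots> \<le> (\<Sum>n=m..<M. (2::rat) ^ j * (1 / (of_nat n * (of_nat n + 1))))"
      using M(1) by (intro sum_mono2) auto
    also have "\<dots> = 2 ^ j * (1 / of_nat m - 1 / of_nat M)"
      using sum_inverse_consecutive[OF m M(2)] by (simp only: flip: sum_distrib_left)
    also have "\<dots> \<le> 2 ^ j * (1 / of_nat m)" by (intro mult_left_mono) auto
    finally show "j \<in> ?R" by (simp add: algebra_simps)
  qed
  ultimately show ?thesis by (rule ultrafilter_superset[OF D])
qed

end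

section \<open>Linkedness of the poset\<close>

lemma ones_append_False: "ones (d @ replicate j False) = ones d"
proof (rule set_eqI)
  fix n
  have "\<not> replicate j False ! (n - length d)" if "\<not> n < length d" "n < length d + j"
    using that by (subst nth_replicate) auto
  then show "n \<in> ones (d @ replicate j False) \<longleftrightarrow> n \<in> ones d"
    by (cases "n < length d") (auto simp: ones_def nth_append)
qed

lemma seqs_append_zeros:
  assumes "s \<in> seqs b (length d)" "\<And>n. 0 < b n"
  shows "s @ replicate j 0 \<in> seqs b (length (d @ replicate j False))"
  using assms by (auto simp: seqs_def nth_append)

text \<open>
  No slalom restricts \<open>s ! n\<close> at positions where \<open>d\<close> is zero, so appending zeros to \<open>d'\<close> is free, and it
  moves the place from which the slalom must be small to where the union of the slaloms is small.
\<close>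

lemma common_lower_bound:
  assumes b: "\<And>n. 0 < b n" and F: "finite F" "F \<subseteq> LE b" and s': "s' \<in> seqs b (length d')"
    and stem: "\<And>d s \<phi>. (d, s, \<phi>) \<in> F \<Longrightarrow>
      prefix d d' \<and> prefix s s' \<and> (\<forall>n \<in> ones d' - ones d. s' ! n \<notin> \<phi> n)"
  shows "\<exists>r\<in>LE b. \<forall>p\<in>F. LE_le r p"
proof -
  let ?\<Phi> = "(\<lambda>p. snd (snd p)) ` F"
  let ?\<psi> = "\<lambda>n. \<Union>\<phi>\<in>?\<Phi>. \<phi> n"
  have "\<exists>m k. slalom_bound b m k ?\<psi>"
  proof (rule slalom_bound_UN)
    fix \<phi> assume "\<phi> \<in> ?\<Phi>"
    then obtain d s where "(d, s, \<phi>) \<in> LE b" using F(2) by force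
    then show "\<exists>m k. slalom_bound b m k \<phi>" by (auto simp: LE_def)
  qed (simp add: F(1))
  then obtain m k where "slalom_bound b m k ?\<psi>" by blast
  then have bound: "slalom_bound b (length (d' @ replicate m False)) k ?\<psi>"
    by (rule slalom_bound_mono) auto
  let ?r = "(d' @ replicate m False, s' @ replicate m 0, ?\<psi>)"
  have "?\<psi> n \<subseteq> {..<b n}" for n using F(2) by (force simp: LE_def)
  then have "?r \<in> LE b"
    unfolding LE_def using bound seqs_append_zeros[OF s' b] by blast
  moreover have "LE_le ?r p" if p: "p \<in> F" for p
  proof -
    obtain d s \<phi> where [simp]: "p = (d, s, \<phi>)" by (metis prod_cases3)
    have "\<phi> n \<subseteq> ?\<psi> n" for n using p by force
    moreover have "(s' @ replicate m 0) ! n \<notin> \<phi> n" if n: "n \<in> ones d' - ones d" for n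
    proof -
      have "n < length s'" using n s' by (auto simp: ones_def seqs_def)
      then show ?thesis using stem p n by (auto simp: nth_append)
    qed
    moreover have "prefix d d'" "prefix s s'" using stem p by auto
    ultimately show ?thesis by (simp add: ones_append_False prefix_append)
  qed
  ultimately show ?thesis by blast
qed

lemma LE_Q_subset: "LE_Q b d s k \<subseteq> LE b"
  by (auto simp: LE_Q_def)

lemma centered_LE_Q:
  assumes "\<And>n. 0 < b n" "s \<in> seqs b (length d)"
  shows "forcing_poset.centered (LE b) LE_le (LE_Q b d s k)"
proof -
  interpret forcing_poset "LE b" LE_le by (rule forcing_poset_LE)
  have "\<exists>r\<in>LE b. \<forall>q\<in>F. LE_le r q" if "finite F" "F \<subseteq> LE_Q b d s k" for F
    using that LE_Q_subset by (intro common_lower_bound[OF assms(1) _ _ assms(2)]) (auto simp: LE_Q_def)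
  then show ?thesis unfolding centered_def by (simp add: LE_Q_subset)
qed

lemma lim_linked_LE_Q:
  assumes b: "\<And>n. 0 < b n" and s: "s \<in> seqs b (length d)" and d: "long k d"
    and D: "ultrafilter D" and \<epsilon>: "1 / rat_of_nat (length d) \<le> \<epsilon>"
  shows "forcing_poset.lim_linked (LE b) LE_le D \<epsilon> (LE_Q b d s k)"
proof -
  interpret forcing_poset "LE b" LE_le by (rule forcing_poset_LE)
  define sl :: "(nat \<Rightarrow> cond) \<Rightarrow> nat \<Rightarrow> nat \<Rightarrow> nat set" where "sl q l = snd (snd (q l))" for q l
  have q_eq: "q l = (d, s, sl q l)" and sub: "sl q l n \<subseteq> {..<b n}"
    and bound: "slalom_bound b (length d) k (sl q l)" if "q \<in> UNIV \<rightarrow> LE_Q b d s k"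
    for q :: "nat \<Rightarrow> cond" and l n
  proof -
    have "q l \<in> LE_Q b d s k" using that by auto
    then show "q l = (d, s, sl q l)" "sl q l n \<subseteq> {..<b n}" "slalom_bound b (length d) k (sl q l)"
      by (auto simp: LE_Q_def LE_def sl_def subset_iff)
  qed
  show ?thesis
  proof (rule lim_linkedI[OF D LE_Q_subset, where limit = "\<lambda>q. (d, s, limit_slalom D (sl q))"])
    show "(\<lambda>q. (d, s, limit_slalom D (sl q))) \<in> (UNIV \<rightarrow> LE_Q b d s k) \<rightarrow> LE b"
    proof
      fix q :: "nat \<Rightarrow> cond" assume q: "q \<in> UNIV \<rightarrow> LE_Q b d s k"
      have "slalom_bound b (length d) (Suc k) (limit_slalom D (sl q))"
        by (rule limit_slalom_bound[OF D d b sub[OF q] bound[OF q]])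
      moreover have "limit_slalom D (sl q) n \<subseteq> {..<b n}" for n
        by (rule limit_slalom_subset[OF D sub[OF q]])
      ultimately show "(d, s, limit_slalom D (sl q)) \<in> LE b"
        unfolding LE_def using s by blast
    qed
  next
    fix r E A
    assume r: "r \<in> LE b" and E: "finite E" "E \<subseteq> UNIV \<rightarrow> LE_Q b d s k"
      and below: "\<And>q. q \<in> E \<Longrightarrow> LE_le r (d, s, limit_slalom D (sl q))" and A: "A \<in> D"
    obtain d' s' \<psi> where r_eq: "r = (d', s', \<psi>)" by (metis prod_cases3)
    let ?N = "ones d' - ones d"
    \<comment> \<open>the \<open>l\<close> for which the stem \<open>(d', s')\<close> obeys the condition \<open>q l\<close>\<close>
    define H where "H j q = {l \<in> interval j. \<forall>n\<in>?N. s' ! n \<notin> sl q l n}" for j q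
    define J where "J q = {j. (1 - \<epsilon>) * 2 ^ j \<le> of_nat (card (H j q))}" for q
    have many: "J q \<in> D" if q: "q \<in> E" for q
    proof -
      have "prefix d d'" and avoid: "\<And>n. n \<in> ?N \<Longrightarrow> s' ! n \<notin> limit_slalom D (sl q) n"
        using below[OF q] by (auto simp: r_eq)
      then have "?N \<subseteq> {length d..}"
        by (auto simp: ones_def prefix_def nth_append not_less[symmetric])
      moreover have "1 \<le> length d" using d by (simp add: long_def)
      moreover have "finite ?N" by (simp add: ones_def)
      ultimately have "{j. (1 - 1 / rat_of_nat (length d)) * 2 ^ j \<le> of_nat (card (H j q))} \<in> D"
        unfolding H_def using avoid by (intro avoids_limit_slalom[OF D]) auto
      moreover have "(1 - \<epsilon>) * 2 ^ j \<le> (1 - 1 / rat_of_nat (length d)) * 2 ^ j" for j :: nat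
        using \<epsilon> by (intro mult_right_mono) auto
      then have "{j. (1 - 1 / rat_of_nat (length d)) * 2 ^ j \<le> of_nat (card (H j q))}
          \<subseteq> J q"
        unfolding J_def by (intro Collect_mono impI) (rule order_trans)
      ultimately show ?thesis by (rule ultrafilter_superset[OF D])
    qed
    have "A \<inter> {j. \<forall>q\<in>E. j \<in> J q} \<in> D"
      by (rule ultrafilter_Int[OF D A ultrafilter_finite_Inter[OF D E(1) many]])
    from ultrafilter_member_nonempty[OF D this]
    obtain j where "j \<in> A" and "\<And>q. q \<in> E \<Longrightarrow> j \<in> J q" by blast
    then have j: "j \<in> A" "\<And>q. q \<in> E \<Longrightarrow> (1 - \<epsilon>) * 2 ^ j \<le> of_nat (card (H j q))"
      by (auto simp: J_def)
    let ?F = "insert r (\<Union>q\<in>E. q ` H j q)"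
    have "\<exists>r'\<in>LE b. \<forall>p\<in>?F. LE_le r' p"
    proof (rule common_lower_bound[OF b])
      show "finite ?F" using E(1) by (simp add: H_def finite_interval)
      show "?F \<subseteq> LE b" using r E(2) LE_Q_subset by blast
      show "s' \<in> seqs b (length d')" using r by (simp add: r_eq LE_def)
    next
      fix e t \<phi> assume "(e, t, \<phi>) \<in> ?F"
      then consider "(e, t, \<phi>) = r" | q l where "q \<in> E" "l \<in> H j q" "(e, t, \<phi>) = q l" by blast
      then show "prefix e d' \<and> prefix t s' \<and> (\<forall>n\<in>ones d' - ones e. s' ! n \<notin> \<phi> n)"
      proof cases
        case 1
        then show ?thesis by (simp add: r_eq)
      next
        case 2
        have "q \<in> UNIV \<rightarrow> LE_Q b d s k" using 2(1) E(2) by blast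
        then have "e = d" "t = s" "\<phi> = sl q l" using 2(3) q_eq[of q l] by auto
        then show ?thesis using below[OF 2(1)] 2(2) by (simp add: r_eq H_def)
      qed
    qed
    then have "\<exists>r'\<in>LE b. LE_le r' r \<and> (\<forall>q\<in>E. \<forall>l\<in>H j q. LE_le r' (q l))" by blast
    moreover have "H j q \<subseteq> interval j" for q by (auto simp: H_def)
    ultimately show "\<exists>k\<in>A. \<exists>H. (\<forall>q\<in>E. H q \<subseteq> interval k \<and> (1 - \<epsilon>) * 2 ^ k \<le> of_nat (card (H q))) \<and>
        (\<exists>r'\<in>LE b. LE_le r' r \<and> (\<forall>q\<in>E. \<forall>l\<in>H q. LE_le r' (q l)))"
      using j by blast
  qed
qed

lemma eventually_long_bound:
  "eventually (\<lambda>n. 2 powr (- (real n / 2 ^ k)) \<le> 1 / ((real n)\<^sup>2 * (real n + 1)\<^sup>2)) sequentially"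
proof -
  define c :: real where "c = 1 / 2 ^ k"
  have "c > 0" by (simp add: c_def)
  then have "eventually (\<lambda>n. 2 powr (- (real n * c)) \<le> 1 / ((real n)\<^sup>2 * (real n + 1)\<^sup>2)) sequentially"
    by real_asymp
  then show ?thesis by (simp add: c_def)
qed

definition long_stems :: "(nat \<Rightarrow> nat) \<Rightarrow> rat \<Rightarrow> (bool list \<times> nat list \<times> nat) set" where
  "long_stems b \<epsilon> =
     {(d, s, k). s \<in> seqs b (length d) \<and> long k d \<and> 1 / rat_of_nat (length d) \<le> \<epsilon>}"

lemma long_stems_dense:
  assumes b: "\<And>n. 0 < b n" and p: "p \<in> LE b" and \<epsilon>: "0 < \<epsilon>"
  shows "\<exists>(d, s, k) \<in> long_stems b \<epsilon>. \<exists>q \<in> LE_Q b d s k. LE_le q p"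
proof -
  obtain d s \<phi> k where p_eq: "p = (d, s, \<phi>)" and s: "s \<in> seqs b (length d)"
    and \<phi>: "\<And>n. \<phi> n \<subseteq> {..<b n}" "slalom_bound b (length d) k \<phi>"
    using p by (auto simp: LE_def)
  obtain N where N: "\<And>n. N \<le> n \<Longrightarrow> 2 powr (- (real n / 2 ^ k)) \<le> 1 / ((real n)\<^sup>2 * (real n + 1)\<^sup>2)"
    using eventually_long_bound[of k] by (auto simp: eventually_sequentially)
  obtain M where M: "1 / \<epsilon> \<le> rat_of_nat M" using real_arch_simple by blast
  let ?j = "Suc (Suc (max N M))"
  let ?d = "d @ replicate ?j False" and ?s = "s @ replicate ?j 0"
  have "rat_of_nat M \<le> rat_of_nat (length ?d)" by (simp only: of_nat_le_iff) simp
  then have "1 / \<epsilon> \<le> rat_of_nat (length ?d)" using M by linarith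
  then have "1 / rat_of_nat (length ?d) \<le> \<epsilon>"
    using \<epsilon> by (simp add: field_simps del: length_append)
  moreover have "long k ?d" unfolding long_def using N by auto
  moreover have s': "?s \<in> seqs b (length ?d)" by (rule seqs_append_zeros[OF s b])
  ultimately have "(?d, ?s, k) \<in> long_stems b \<epsilon>" by (simp add: long_stems_def)
  moreover have "slalom_bound b (length ?d) k \<phi>" by (rule slalom_bound_mono[OF \<phi>(2)]) auto
  then have "(?d, ?s, \<phi>) \<in> LE_Q b ?d ?s k"
    unfolding LE_Q_def LE_def using s' \<phi>(1) by blast
  moreover have "LE_le (?d, ?s, \<phi>) p"
    by (simp add: p_eq ones_append_False del: replicate.simps)
  ultimately show ?thesis by blast
qed

text \<open>
  There are only countably many triples \<open>(d, s, k)\<close>, and \<open>(D, \<epsilon>)\<close>-linkedness only requires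
  \<open>1 / length d \<le> \<epsilon>\<close>, which any condition achieves after appending zeros.
\<close>

lemma sigma_UFIC_lim_linked_LE:
  assumes b: "\<And>n. 0 < b n"
  shows "forcing_poset.sigma_UFIC_lim_linked (LE b) LE_le"
proof -
  interpret forcing_poset "LE b" LE_le by (rule forcing_poset_LE)
  define e where "e \<epsilon> = from_nat_into (long_stems b \<epsilon>)" for \<epsilon>
  define Q where "Q \<alpha> \<epsilon> = (case e \<epsilon> \<alpha> of (d, s, k) \<Rightarrow> LE_Q b d s k)" for \<alpha> \<epsilon>
  have range: "range (e \<epsilon>) = long_stems b \<epsilon>" if "0 < \<epsilon>" for \<epsilon>
  proof -
    have "([], [], \<lambda>_. {}) \<in> LE b" by (simp add: LE_def seqs_def slalom_bound_def)
    from long_stems_dense[OF b this that] have "long_stems b \<epsilon> \<noteq> {}" by auto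
    then show ?thesis unfolding e_def by (rule range_from_nat_into) simp
  qed
  show ?thesis
    unfolding sigma_UFIC_lim_linked_def
  proof (intro exI[of _ Q] allI impI conjI)
    fix \<epsilon> :: rat and \<alpha> assume \<epsilon>: "0 < \<epsilon> \<and> \<epsilon> < 1"
    obtain d s k where dsk: "e \<epsilon> \<alpha> = (d, s, k)" by (metis prod_cases3)
    then have "(d, s, k) \<in> long_stems b \<epsilon>" using range \<epsilon> by (metis rangeI)
    then have stem: "s \<in> seqs b (length d)" "long k d" "1 / rat_of_nat (length d) \<le> \<epsilon>"
      by (auto simp: long_stems_def)
    show "Q \<alpha> \<epsilon> \<subseteq> LE b" "centered (Q \<alpha> \<epsilon>)"
      using LE_Q_subset centered_LE_Q[OF b stem(1)] by (auto simp: Q_def dsk)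
    fix D assume "nonprincipal_ultrafilter D"
    then show "lim_linked D \<epsilon> (Q \<alpha> \<epsilon>)"
      using lim_linked_LE_Q[OF b stem(1,2) _ stem(3)] by (simp add: Q_def dsk nonprincipal_ultrafilter_def)
  next
    fix \<epsilon> :: rat assume \<epsilon>: "0 < \<epsilon> \<and> \<epsilon> < 1"
    have "\<exists>q\<in>\<Union>\<alpha>. Q \<alpha> \<epsilon>. LE_le q p" if "p \<in> LE b" for p
    proof -
      obtain d s k q where q: "(d, s, k) \<in> long_stems b \<epsilon>" "q \<in> LE_Q b d s k" "LE_le q p"
        using long_stems_dense[OF b \<open>p \<in> LE b\<close>] \<epsilon> by blast
      then obtain \<alpha> where "e \<epsilon> \<alpha> = (d, s, k)" using range \<epsilon> by (metis imageE)
      then have "q \<in> Q \<alpha> \<epsilon>" using q(2) by (simp add: Q_def)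
      then show ?thesis using q(3) by blast
    qed
    moreover have "Q \<alpha> \<epsilon> \<subseteq> LE b" for \<alpha> using LE_Q_subset by (auto simp: Q_def split: prod.split)
    ultimately show "dense (\<Union>\<alpha>. Q \<alpha> \<epsilon>)" unfolding dense_def by blast
  qed
qed

theorem theorem4p34:
  fixes b :: "nat \<Rightarrow> nat"
  assumes "\<And>n. 2 ^ n \<le> b n"
  shows "(\<forall>d s k D. s \<in> seqs b (length d) \<and> long k d \<and> nonprincipal_ultrafilter D \<longrightarrow>
            forcing_poset.lim_linked (LE b) LE_le D (1 / rat_of_nat (length d)) (LE_Q b d s k))
         \<and> forcing_poset.sigma_UFIC_lim_linked (LE b) LE_le"
proof -
  have b: "0 < b n" for n using assms[of n] by (meson less_le_trans zero_less_numeral zero_less_power)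
  then show ?thesis
    using lim_linked_LE_Q sigma_UFIC_lim_linked_LE by (auto simp: nonprincipal_ultrafilter_def)
qed

end
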